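(* Let $K$ be a field, $M$ an affine monoid, and let $x_1,\dots,x_n$, $n\ge 2$, be noninvertible elements of $M$. Then the following statements (1) and (2) are equivalent: (1) $X^{x_1}-X^{x_2},\dots,X^{x_{n-1}}-X^{x_n}$ is a $K[M]$-sequence and generates a prime ideal. (2) (a) $X^{x_1},\dots,X^{x_n}$ is a $K[M]$-sequence; and (b) $x_1-x_2,\dots,x_{n-1}-x_n$ generate a rank $n-1$ direct summand of $\operatorname{gp}(M)$.
   Context: An affine monoid is a finitely generated submonoid $M$ of some group $\mathbb{Z}^m$ (written additively). $\operatorname{gp}(M)\subset\mathbb{Z}^m$ is the subgroup generated by $M$. An element $x\in M$ is invertible if $-x\in M$. $K[M]$ is the monoid algebra; $X^x$ denotes the monomial with exponent vector $x$. A sequence $f_1,\dots,f_r$ in a ring $R$ is an $R$-sequence (regular sequence) if each $f_i$ is a nonzerodivisor on $R/(f_1,\dots,f_{i-1})$ and $(f_1,\dots,f_r)\neq R$. *)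

theory Defs
  imports
    "HOL-Analysis.Finite_Cartesian_Product"
    "HOL-Library.Poly_Mapping"
    "HOL-Algebra.QuotRing"
    "HOL-Algebra.Generated_Groups"
begin

section \<open>Affine monoids\<close>

text \<open>The additive group \<open>\<int>\<^sup>m\<close>, so that \<^const>\<open>submonoid\<close>, \<^const>\<open>subgroup\<close>,
  \<^const>\<open>generate\<close> and \<^const>\<open>set_mult\<close> apply to it.\<close>

definition lattice_group :: "(int ^ 'm) monoid"
  where "lattice_group = \<lparr>carrier = UNIV, mult = (+), one = 0\<rparr>"

definition affine_monoid :: "(int ^ 'm) set \<Rightarrow> bool"
  where "affine_monoid M \<longleftrightarrow>
    (\<exists>S. finite S \<and> M = (\<lambda>N. submonoid N lattice_group) hull S)"

definition gp :: "(int ^ 'm) set \<Rightarrow> (int ^ 'm) set"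
  where "gp M = generate lattice_group M"

definition invertible_in :: "(int ^ 'm) set \<Rightarrow> int ^ 'm \<Rightarrow> bool"
  where "invertible_in M x \<longleftrightarrow> x \<in> M \<and> - x \<in> M"

definition direct_summand :: "(int ^ 'm) set \<Rightarrow> (int ^ 'm) set \<Rightarrow> bool"
  where "direct_summand H G \<longleftrightarrow>
    subgroup H lattice_group \<and>
    (\<exists>C. subgroup C lattice_group \<and> H <#>\<^bsub>lattice_group\<^esub> C = G \<and> H \<inter> C = {0})"

global_interpretation int_lattice: module "(*s) :: int \<Rightarrow> int ^ 'm \<Rightarrow> int ^ 'm"
  by unfold_locales (simp_all add: vec_eq_iff vector_scalar_mult_def algebra_simps)

text \<open>The rank of a subgroup is the maximal number of \<open>\<int>\<close>-linearly independent elements;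
  the maximum exists because such a number is at most \<open>m\<close>.\<close>

definition lattice_rank :: "(int ^ 'm) set \<Rightarrow> nat"
  where "lattice_rank H = Max {card B | B. B \<subseteq> H \<and> finite B \<and> int_lattice.independent B}"

section \<open>Monoid algebras\<close>

text \<open>\<open>K[M]\<close> is the subring of the group algebra \<open>K[\<int>\<^sup>m]\<close> (finitely supported functions
  with the convolution product) of the elements supported in \<open>M\<close>.\<close>

definition monoid_algebra :: "(int ^ 'm) set \<Rightarrow> ((int ^ 'm) \<Rightarrow>\<^sub>0 'k::field) ring"
  where "monoid_algebra M =
    \<lparr>carrier = {p. Poly_Mapping.keys p \<subseteq> M}, mult = (*), one = 1, zero = 0, add = (+)\<rparr>"

definition monomial :: "int ^ 'm \<Rightarrow> (int ^ 'm) \<Rightarrow>\<^sub>0 'k::field"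
  where "monomial x = Poly_Mapping.single x 1"

section \<open>Regular sequences\<close>

definition nonzerodivisor :: "('a, 'b) ring_scheme \<Rightarrow> 'a \<Rightarrow> bool"
  where "nonzerodivisor R f \<longleftrightarrow>
    f \<in> carrier R \<and> (\<forall>a\<in>carrier R. f \<otimes>\<^bsub>R\<^esub> a = \<zero>\<^bsub>R\<^esub> \<longrightarrow> a = \<zero>\<^bsub>R\<^esub>)"

definition regular_sequence :: "('a, 'b) ring_scheme \<Rightarrow> 'a list \<Rightarrow> bool"
  where "regular_sequence R fs \<longleftrightarrow>
    set fs \<subseteq> carrier R \<and>
    (\<forall>i<length fs. let I = Idl\<^bsub>R\<^esub> (set (take i fs)) in
      nonzerodivisor (R Quot I) (I +>\<^bsub>R\<^esub> (fs ! i))) \<and>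
    Idl\<^bsub>R\<^esub> (set fs) \<noteq> carrier R"

end

theory Submission
  imports Defs "HOL-Library.Multiset"
begin

text \<open>
Write \<open>G = gp(M)\<close>, let \<open>U\<close> be the subgroup generated by the differences \<open>x\<^sub>i - x\<^sub>i\<^sub>+\<^sub>1\<close>, let
\<open>I\<close> be the ideal generated by the binomials \<open>X^x\<^sub>i - X^x\<^sub>i\<^sub>+\<^sub>1\<close>, and let \<open>Q\<close> be the kernel of
\<open>K[M] \<rightarrow> K[G/U]\<close>, that is, the set of elements all of whose coefficient sums over cosets of \<open>U\<close>
vanish (\<open>balanced U\<close>). Always \<open>I \<subseteq> Q\<close>, so \<open>I\<close> contains no monomial. Moreover, if \<open>a\<close> and \<open>b\<close> in
\<open>M\<close> are congruent modulo \<open>U\<close>, then \<open>X^q (X^a - X^b) \<in> I\<close> for some \<open>q \<in> M\<close>: clearing negative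
coefficients gives \<open>a + \<Sum>q\<^sub>i x\<^sub>i = b + \<Sum>p\<^sub>i x\<^sub>i\<close> with \<open>\<Sum>p\<^sub>i = \<Sum>q\<^sub>i\<close>, and modulo \<open>I\<close> all \<open>X^x\<^sub>i\<close>
agree.

The monomials \<open>X^x\<^sub>1, \<dots>, X^x\<^sub>n\<close> form a regular sequence exactly if they do so in pairs:
\<open>a + x\<^sub>i \<in> x\<^sub>j + M\<close> implies \<open>a \<in> x\<^sub>j + M\<close> for all \<open>i \<noteq> j\<close> and \<open>a \<in> M\<close>
(\<open>regular_monomials_iff\<close>). The point is that such sequences may be permuted; the Nakayama argument
behind this is Dickson's lemma, since \<open>a - k x\<^sub>s \<in> M\<close> for all \<open>k\<close> would make \<open>x\<^sub>s\<close> invertible.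
The generators of \<open>U\<close> number \<open>n - 1\<close>, so \<open>U\<close> has rank \<open>n - 1\<close> exactly if \<open>x\<^sub>1, \<dots>, x\<^sub>n\<close> are
affinely independent over \<open>\<int>\<close>; and \<open>U\<close> is a direct summand of \<open>G\<close> exactly if \<open>G/U\<close> is
torsion-free.

From the monomials to the binomials: for \<open>a - b \<in> U\<close> choose the \<open>p\<^sub>i\<close> and \<open>q\<^sub>i\<close> above with disjoint
supports. Pairwise regularity then splits off the sums, \<open>a = w + \<Sum>p\<^sub>i x\<^sub>i\<close> and
\<open>b = w + \<Sum>q\<^sub>i x\<^sub>i\<close> with \<open>w \<in> M\<close>, so that \<open>X^a - X^b \<in> I\<close>. Hence \<open>I = Q\<close>
(\<open>binomial_ideal_eq_balanced\<close>). The group algebra of a torsion-free abelian group is a domain, so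
\<open>Q\<close> is prime. All this applies to every initial segment \<open>x\<^sub>1, \<dots>, x\<^sub>k\<close>, where \<open>G/U\<^sub>k\<close> is again
torsion-free by affine independence; and a nonzero element modulo a prime ideal is a
nonzerodivisor (\<open>binomials_regular_and_prime\<close>).

From the binomials to the monomials: let \<open>N\<close> be the order of \<open>a - b\<close> in \<open>G/U\<close>. Factor
\<open>X^(Na) - X^(Nb)\<close> as \<open>X^a - X^b\<close> times a geometric sum; the terms of the sum lie in different cosets
of \<open>U\<close>, so the sum is not in \<open>Q\<close> (\<open>torsion_witness\<close>). If \<open>I\<close> is prime, then \<open>X^a - X^b \<in> I\<close>,
which forces \<open>N = 1\<close>: so \<open>G/U\<close> is torsion-free. The same factorization at step \<open>k\<close> of the regular
sequence yields affine independence. As \<open>I\<close> is prime and contains no monomial, \<open>a - b \<in> U\<close>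
implies \<open>X^a - X^b \<in> I\<close>, and \<open>I\<close> lies in the ideal generated by the \<open>X^x\<^sub>i\<close>; so of two distinct
congruent elements of \<open>M\<close> each is divisible by some \<open>x\<^sub>i\<close>. Therefore the elements of \<open>M\<close> in a
coset of the group generated by the \<open>x\<^sub>i\<close> are the sums \<open>e + \<Sum>p\<^sub>i x\<^sub>i\<close> for a single \<open>e \<in> M\<close>, namely
one of lowest degree, which exists by Dickson's lemma. Since the \<open>p\<^sub>i\<close> are unique by affine
independence, comparing coefficients in \<open>a + x\<^sub>i = z + x\<^sub>j\<close> gives pairwise regularity
(\<open>pairwise_regular_if_prime\<close>).
\<close>

section \<open>Subgroups of the lattice\<close>

lemma lattice_group_simps [simp]:
  "carrier lattice_group = UNIV" "x \<otimes>\<^bsub>lattice_group\<^esub> y = x + y" "\<one>\<^bsub>lattice_group\<^esub> = 0"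
  by (simp_all add: lattice_group_def)

lemma comm_group_lattice_group: "comm_group (lattice_group :: (int ^ 'm) monoid)"
proof (rule comm_groupI)
  fix x :: "int ^ 'm"
  show "\<exists>y\<in>carrier lattice_group. y \<otimes>\<^bsub>lattice_group\<^esub> x = \<one>\<^bsub>lattice_group\<^esub>"
    by (rule bexI[of _ "- x"]) simp_all
qed (simp_all add: algebra_simps)

lemma group_lattice_group: "group (lattice_group :: (int ^ 'm) monoid)"
  by (rule comm_group.axioms(2)[OF comm_group_lattice_group])

lemma inv_lattice_group [simp]: "inv\<^bsub>lattice_group\<^esub> x = - (x :: int ^ 'm)"
  by (rule group.inv_equality[OF group_lattice_group]) simp_all

lemma submonoid_lattice_iff:
  "submonoid N lattice_group \<longleftrightarrow> 0 \<in> N \<and> (\<forall>a\<in>N. \<forall>b\<in>N. a + b \<in> (N :: (int ^ 'm) set))"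
  by (auto simp: submonoid_def)

lemma subgroup_lattice_iff:
  "subgroup H lattice_group \<longleftrightarrow>
     0 \<in> H \<and> (\<forall>a\<in>H. \<forall>b\<in>H. a + b \<in> H) \<and> (\<forall>a\<in>H. - a \<in> (H :: (int ^ 'm) set))"
  by (auto simp: subgroup_def)

lemma lattice_subgroup_closed:
  assumes "subgroup H lattice_group"
  shows "0 \<in> H" "a \<in> H \<Longrightarrow> b \<in> H \<Longrightarrow> a + b \<in> H" "a \<in> H \<Longrightarrow> - a \<in> H"
    and "a \<in> H \<Longrightarrow> b \<in> H \<Longrightarrow> a - b \<in> H"
  using assms unfolding subgroup_lattice_iff by (auto simp flip: add_uminus_conv_diff)

lemma lattice_subgroup_nat_scale:
  fixes a :: "int ^ 'm"
  assumes "subgroup H lattice_group" "a \<in> H"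
  shows "int k *s a \<in> H"
proof (induct k)
  case 0 then show ?case using lattice_subgroup_closed[OF assms(1)] by simp
next
  case (Suc k)
  have "int (Suc k) *s a = int k *s a + a" by (simp add: int_lattice.scale_left_distrib)
  with Suc assms lattice_subgroup_closed(2)[OF assms(1)] show ?case by metis
qed

lemma lattice_subgroup_scale:
  fixes a :: "int ^ 'm"
  assumes "subgroup H lattice_group" "a \<in> H"
  shows "c *s a \<in> H"
proof (cases "c \<ge> 0")
  case True
  then show ?thesis using lattice_subgroup_nat_scale[OF assms, of "nat c"] by simp
next
  case False
  then have "c *s a = - (int (nat (- c)) *s a)" by simp
  then show ?thesis using lattice_subgroup_nat_scale[OF assms] lattice_subgroup_closed(3)[OF assms(1)] by metis
qed

lemma lattice_subgroup_sum:
  assumes "subgroup H lattice_group" "\<And>i. i \<in> A \<Longrightarrow> f i \<in> H"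
  shows "sum f A \<in> H"
  using assms(2)
  by (induct A rule: infinite_finite_induct) (auto simp: lattice_subgroup_closed[OF assms(1)])

lemma subgroup_generate_lattice: "subgroup (generate lattice_group S) (lattice_group :: (int ^ 'm) monoid)"
  by (rule group.generate_is_subgroup[OF group_lattice_group]) simp

lemma generate_lattice_minimal:
  assumes "subgroup H (lattice_group :: (int ^ 'm) monoid)" "S \<subseteq> H"
  shows "generate lattice_group S \<subseteq> H"
  by (rule group.generate_subgroup_incl[OF group_lattice_group]) (use assms in auto)

lemma gp_eq_differences:
  assumes "submonoid M (lattice_group :: (int ^ 'm) monoid)"
  shows "gp M = {a - b |a b. a \<in> M \<and> b \<in> M}"
proof
  have M: "0 \<in> M" "\<And>a b. a \<in> M \<Longrightarrow> b \<in> M \<Longrightarrow> a + b \<in> M"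
    using assms by (auto simp: submonoid_lattice_iff)
  let ?D = "{a - b |a b. a \<in> M \<and> b \<in> M}"
  have D: "a - b \<in> ?D" if "a \<in> M" "b \<in> M" for a b using that by blast
  have "subgroup ?D (lattice_group :: (int ^ 'm) monoid)"
    unfolding subgroup_lattice_iff
  proof (intro conjI ballI)
    show "0 \<in> ?D" using D[OF M(1) M(1)] by simp
  next
    fix u v assume "u \<in> ?D" "v \<in> ?D"
    then obtain a b c d where ab: "u = a - b" "v = c - d" "a \<in> M" "b \<in> M" "c \<in> M" "d \<in> M" by blast
    have "u + v = (a + c) - (b + d)" by (simp add: ab)
    then show "u + v \<in> ?D" using D[OF M(2)[OF ab(3,5)] M(2)[OF ab(4,6)]] by metis
  next
    fix u assume "u \<in> ?D"
    then obtain a b where "u = a - b" "a \<in> M" "b \<in> M" by blast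
    then show "- u \<in> ?D" using D[of b a] by simp
  qed
  moreover have "M \<subseteq> ?D"
  proof
    fix a assume "a \<in> M"
    then show "a \<in> ?D" using D[of a 0] M(1) by simp
  qed
  ultimately show "gp M \<subseteq> {a - b |a b. a \<in> M \<and> b \<in> M}"
    unfolding gp_def by (rule generate_lattice_minimal)
next
  have "M \<subseteq> gp M" unfolding gp_def by (auto intro: generate.incl)
  moreover have "subgroup (gp M) lattice_group" unfolding gp_def by (rule subgroup_generate_lattice)
  ultimately show "{a - b |a b. a \<in> M \<and> b \<in> M} \<subseteq> gp M"
    using lattice_subgroup_closed(4) by blast
qed

section \<open>Pushing forward finitely supported functions\<close>

text \<open>For a homomorphism \<open>\<phi>\<close> this is the induced map of monoid algebras. Arbitrary maps are allowed
so that \<open>\<phi>\<close> may also send an element to its coset, as a set.\<close>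

definition push :: "('a \<Rightarrow> 'b) \<Rightarrow> ('a \<Rightarrow>\<^sub>0 'k::comm_monoid_add) \<Rightarrow> ('b \<Rightarrow>\<^sub>0 'k)" where
  "push \<phi> f = (\<Sum>a\<in>Poly_Mapping.keys f. Poly_Mapping.single (\<phi> a) (Poly_Mapping.lookup f a))"

lemma push_superset:
  assumes "finite A" "Poly_Mapping.keys f \<subseteq> A"
  shows "push \<phi> f = (\<Sum>a\<in>A. Poly_Mapping.single (\<phi> a) (Poly_Mapping.lookup f a))"
  unfolding push_def using assms by (intro sum.mono_neutral_left) (auto simp: in_keys_iff)

lemma push_zero [simp]: "push \<phi> 0 = 0"
  by (simp add: push_def)

lemma push_single [simp]: "push \<phi> (Poly_Mapping.single a c) = Poly_Mapping.single (\<phi> a) c"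
  by (subst push_superset[of "{a}"]) auto

lemma push_add: "push \<phi> (f + g) = push \<phi> f + push \<phi> g"
proof -
  let ?A = "Poly_Mapping.keys f \<union> Poly_Mapping.keys g"
  have expand: "push \<phi> h = (\<Sum>a\<in>?A. Poly_Mapping.single (\<phi> a) (Poly_Mapping.lookup h a))"
    if "Poly_Mapping.keys h \<subseteq> ?A" for h
    using that by (intro push_superset) auto
  have "Poly_Mapping.keys (f + g) \<subseteq> ?A" by (rule Poly_Mapping.keys_add)
  then show ?thesis by (simp add: expand lookup_add single_add sum.distrib)
qed

lemma push_diff: "push \<phi> (f - g) = push \<phi> f - push \<phi> (g :: 'a \<Rightarrow>\<^sub>0 'k::ab_group_add)"
  using push_add[of \<phi> "f - g" g] by (simp add: eq_diff_eq)

lemma push_sum: "push \<phi> (sum F A) = (\<Sum>i\<in>A. push \<phi> (F i))"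
  by (induct A rule: infinite_finite_induct) (auto simp: push_add)

lemma lookup_push:
  "Poly_Mapping.lookup (push \<phi> f) v
     = (\<Sum>a | a \<in> Poly_Mapping.keys f \<and> \<phi> a = v. Poly_Mapping.lookup f a)"
  unfolding push_def lookup_sum lookup_single
  by (simp add: when_def sum.If_cases Int_def)

lemma push_eq_0_iff:
  "push \<phi> f = 0 \<longleftrightarrow> (\<forall>a\<in>Poly_Mapping.keys f.
     (\<Sum>b | b \<in> Poly_Mapping.keys f \<and> \<phi> b = \<phi> a. Poly_Mapping.lookup f b) = 0)"
proof
  assume "push \<phi> f = 0"
  then show "\<forall>a\<in>Poly_Mapping.keys f.
     (\<Sum>b | b \<in> Poly_Mapping.keys f \<and> \<phi> b = \<phi> a. Poly_Mapping.lookup f b) = 0"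
    by (simp flip: lookup_push)
next
  assume *: "\<forall>a\<in>Poly_Mapping.keys f.
     (\<Sum>b | b \<in> Poly_Mapping.keys f \<and> \<phi> b = \<phi> a. Poly_Mapping.lookup f b) = 0"
  show "push \<phi> f = 0"
  proof (rule poly_mapping_eqI)
    fix v
    show "Poly_Mapping.lookup (push \<phi> f) v = Poly_Mapping.lookup 0 v"
    proof (cases "\<exists>a\<in>Poly_Mapping.keys f. \<phi> a = v")
      case True
      then obtain a where "a \<in> Poly_Mapping.keys f" "v = \<phi> a" by blast
      then show ?thesis using * by (simp add: lookup_push)
    next
      case False
      then have "{a. a \<in> Poly_Mapping.keys f \<and> \<phi> a = v} = {}" by auto
      then show ?thesis by (simp only: lookup_push sum.empty lookup_zero)
    qed
  qed
qed

text \<open>Vanishing depends only on the partition of the support into fibres. This permits a change from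
the coset map of a subgroup to a homomorphism into an ordered group.\<close>

lemma push_eq_0_cong:
  assumes "\<And>a b. a \<in> Poly_Mapping.keys f \<Longrightarrow> b \<in> Poly_Mapping.keys f \<Longrightarrow> \<phi> a = \<phi> b \<longleftrightarrow> \<psi> a = \<psi> b"
  shows "push \<phi> f = 0 \<longleftrightarrow> push \<psi> f = 0"
proof -
  have "{b. b \<in> Poly_Mapping.keys f \<and> \<phi> b = \<phi> a} = {b. b \<in> Poly_Mapping.keys f \<and> \<psi> b = \<psi> a}"
    if "a \<in> Poly_Mapping.keys f" for a
    using assms that by blast
  then show ?thesis by (simp add: push_eq_0_iff)
qed

lemma poly_mapping_eq_sum_single:
  "(f :: 'a \<Rightarrow>\<^sub>0 'k::comm_monoid_add)
     = (\<Sum>a\<in>Poly_Mapping.keys f. Poly_Mapping.single a (Poly_Mapping.lookup f a))"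
proof -
  have "(\<Sum>a\<in>Poly_Mapping.keys f. Poly_Mapping.lookup f a when a = v) = Poly_Mapping.lookup f v" for v
    by (simp add: when_def in_keys_iff)
  then show ?thesis by (intro poly_mapping_eqI) (simp add: lookup_sum lookup_single)
qed

lemma push_mult:
  fixes f g :: "'a::monoid_add \<Rightarrow>\<^sub>0 'k::comm_semiring_1" and \<phi> :: "'a \<Rightarrow> 'b::monoid_add"
  assumes "\<And>a b. \<phi> (a + b) = \<phi> a + \<phi> b"
  shows "push \<phi> (f * g) = push \<phi> f * push \<phi> g"
proof -
  have "f * g = (\<Sum>a\<in>Poly_Mapping.keys f. Poly_Mapping.single a (Poly_Mapping.lookup f a))
      * (\<Sum>b\<in>Poly_Mapping.keys g. Poly_Mapping.single b (Poly_Mapping.lookup g b))"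
    by (rule arg_cong2[where f = "(*)", OF poly_mapping_eq_sum_single poly_mapping_eq_sum_single])
  then have "push \<phi> (f * g) = (\<Sum>a\<in>Poly_Mapping.keys f. \<Sum>b\<in>Poly_Mapping.keys g.
      Poly_Mapping.single (\<phi> a + \<phi> b) (Poly_Mapping.lookup f a * Poly_Mapping.lookup g b))"
    by (simp only: sum_product push_sum mult_single assms push_single)
  also have "\<dots> = push \<phi> f * push \<phi> g"
    by (simp add: push_def sum_product mult_single)
  finally show ?thesis .
qed

text \<open>Translation permutes the fibres of \<open>\<phi>\<close>, so multiplication by a monomial only permutes the sums of
coefficients over the fibres. This yields the ideal property of the kernel of \<open>K[M] \<rightarrow> K[G/U]\<close>
without a ring structure on the target.\<close>

lemma push_mult_eq_0:
  fixes f g :: "'a::ab_group_add \<Rightarrow>\<^sub>0 'k::comm_semiring_1" and \<phi> :: "'a \<Rightarrow> 'b"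
  assumes \<phi>: "\<And>a b c. \<phi> (c + a) = \<phi> (c + b) \<longleftrightarrow> \<phi> a = \<phi> b" and g: "push \<phi> g = 0"
  shows "push \<phi> (f * g) = 0"
proof -
  have single: "push \<phi> (Poly_Mapping.single c k * g) = 0" for c k
  proof (rule poly_mapping_eqI)
    fix v
    have "Poly_Mapping.single c k * g = Poly_Mapping.single c k
        * (\<Sum>b\<in>Poly_Mapping.keys g. Poly_Mapping.single b (Poly_Mapping.lookup g b))"
      by (rule arg_cong[where f = "(*) (Poly_Mapping.single c k)", OF poly_mapping_eq_sum_single])
    then have "Poly_Mapping.lookup (push \<phi> (Poly_Mapping.single c k * g)) v
        = (\<Sum>b | b \<in> Poly_Mapping.keys g \<and> \<phi> (c + b) = v. k * Poly_Mapping.lookup g b)"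
      by (simp add: sum_distrib_left mult_single push_sum lookup_sum lookup_single when_def
          sum.If_cases Int_def)
    also have "\<dots> = 0"
    proof (cases "\<exists>b0\<in>Poly_Mapping.keys g. \<phi> (c + b0) = v")
      case True
      then obtain b0 where b0: "b0 \<in> Poly_Mapping.keys g" "v = \<phi> (c + b0)" by blast
      have "(\<Sum>b | b \<in> Poly_Mapping.keys g \<and> \<phi> (c + b) = v. k * Poly_Mapping.lookup g b)
          = k * (\<Sum>b | b \<in> Poly_Mapping.keys g \<and> \<phi> b = \<phi> b0. Poly_Mapping.lookup g b)"
        by (simp add: b0(2) \<phi> sum_distrib_left)
      also have "\<dots> = 0" using g b0(1) by (simp add: push_eq_0_iff)
      finally show ?thesis .
    next
      case False
      then have "{b. b \<in> Poly_Mapping.keys g \<and> \<phi> (c + b) = v} = {}" by auto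
      then show ?thesis by (simp only: sum.empty)
    qed
    finally show "Poly_Mapping.lookup (push \<phi> (Poly_Mapping.single c k * g)) v = Poly_Mapping.lookup 0 v"
      by simp
  qed
  have "f * g = (\<Sum>a\<in>Poly_Mapping.keys f. Poly_Mapping.single a (Poly_Mapping.lookup f a)) * g"
    by (rule arg_cong[where f = "\<lambda>h. h * g", OF poly_mapping_eq_sum_single])
  then show ?thesis by (simp only: sum_distrib_right push_sum single sum.neutral_const)
qed


section \<open>Ideals of a monoid algebra\<close>

lemma monomial_mult: "monomial a * monomial b = (monomial (a + b) :: (int ^ 'm) \<Rightarrow>\<^sub>0 'k::field)"
  by (simp add: monomial_def mult_single)

lemma keys_monomial [simp]: "Poly_Mapping.keys (monomial a :: (int ^ 'm) \<Rightarrow>\<^sub>0 'k::field) = {a}"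
  by (simp add: monomial_def)

lemma monomial_0: "(monomial 0 :: (int ^ 'm) \<Rightarrow>\<^sub>0 'k::field) = 1"
  by (simp add: monomial_def)

lemma keys_diff_subset: "Poly_Mapping.keys (f - g) \<subseteq> Poly_Mapping.keys f \<union> Poly_Mapping.keys (g :: 'a \<Rightarrow>\<^sub>0 'k::ab_group_add)"
  by (auto simp: in_keys_iff lookup_minus)

text \<open>Monomials are units in the group algebra of \<open>\<int>\<^sup>m\<close>, so no cancellation can occur.\<close>

lemma keys_monomial_mult:
  fixes h :: "(int ^ 'm) \<Rightarrow>\<^sub>0 'k::field"
  shows "Poly_Mapping.keys (monomial c * h) = (\<lambda>a. a + c) ` Poly_Mapping.keys h"
proof
  show "Poly_Mapping.keys (monomial c * h) \<subseteq> (\<lambda>a. a + c) ` Poly_Mapping.keys h"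
    using Poly_Mapping.keys_mult[of "monomial c" h] by (auto simp: add.commute)
  have "h = monomial (- c) * (monomial c * h)"
    by (simp add: monomial_mult monomial_0 flip: mult.assoc)
  then have "Poly_Mapping.keys h \<subseteq> {a + b |a b. a \<in> {- c} \<and> b \<in> Poly_Mapping.keys (monomial c * h)}"
    using Poly_Mapping.keys_mult[of "monomial (- c)" "monomial c * h"] by simp
  then show "(\<lambda>a. a + c) ` Poly_Mapping.keys h \<subseteq> Poly_Mapping.keys (monomial c * h)"
    by fastforce
qed

lemma keys_binomial:
  "a \<noteq> b \<Longrightarrow> a \<in> Poly_Mapping.keys (monomial a - monomial b :: (int ^ 'm) \<Rightarrow>\<^sub>0 'k::field)"
  by (simp add: in_keys_iff lookup_minus monomial_def lookup_single)

locale lattice_monoid_algebra =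
  fixes M :: "(int ^ 'm) set" and R :: "((int ^ 'm) \<Rightarrow>\<^sub>0 'k::field) ring"
  assumes submonoid_M: "submonoid M lattice_group"
    and R_eq: "R = monoid_algebra M"
begin

lemma zero_in_M: "0 \<in> M" and add_in_M: "a \<in> M \<Longrightarrow> b \<in> M \<Longrightarrow> a + b \<in> M"
  using submonoid_M by (auto simp: submonoid_lattice_iff)

lemma scale_in_M: "a \<in> M \<Longrightarrow> int k *s a \<in> M"
  by (induct k) (auto simp: zero_in_M add_in_M int_lattice.scale_left_distrib)

lemma R_simps [simp]:
  "carrier R = {f. Poly_Mapping.keys f \<subseteq> M}"
  "f \<otimes>\<^bsub>R\<^esub> g = f * g" "f \<oplus>\<^bsub>R\<^esub> g = f + g" "\<one>\<^bsub>R\<^esub> = 1" "\<zero>\<^bsub>R\<^esub> = 0"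
  by (simp_all add: R_eq monoid_algebra_def)

lemma mult_carrier:
  fixes f g :: "(int ^ 'm) \<Rightarrow>\<^sub>0 'k"
  assumes "Poly_Mapping.keys f \<subseteq> M" "Poly_Mapping.keys g \<subseteq> M"
  shows "Poly_Mapping.keys (f * g) \<subseteq> M"
  using Poly_Mapping.keys_mult[of f g] assms add_in_M by blast

lemma add_carrier:
  fixes f g :: "(int ^ 'm) \<Rightarrow>\<^sub>0 'k"
  assumes "Poly_Mapping.keys f \<subseteq> M" "Poly_Mapping.keys g \<subseteq> M"
  shows "Poly_Mapping.keys (f + g) \<subseteq> M"
  using Poly_Mapping.keys_add[of f g] assms by blast

lemma diff_carrier:
  fixes f g :: "(int ^ 'm) \<Rightarrow>\<^sub>0 'k"
  assumes "Poly_Mapping.keys f \<subseteq> M" "Poly_Mapping.keys g \<subseteq> M"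
  shows "Poly_Mapping.keys (f - g) \<subseteq> M"
  using keys_diff_subset[of f g] assms by blast

lemma uminus_carrier:
  fixes f :: "(int ^ 'm) \<Rightarrow>\<^sub>0 'k"
  assumes "Poly_Mapping.keys f \<subseteq> M" 
  shows "Poly_Mapping.keys (- f) \<subseteq> M"
  using diff_carrier[of 0 f] assms by simp

lemma cring_R: "cring R"
proof (rule cringI)
  show "abelian_group R"
  proof (rule abelian_groupI)
    fix f assume "f \<in> carrier R"
    then show "\<exists>g\<in>carrier R. g \<oplus>\<^bsub>R\<^esub> f = \<zero>\<^bsub>R\<^esub>"
      by (intro bexI[of _ "- f"]) (simp_all add: uminus_carrier)
  qed (simp_all add: add_carrier algebra_simps)
  show "Group.comm_monoid R"
    by (rule comm_monoidI) (simp_all add: mult_carrier zero_in_M algebra_simps)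
qed (simp_all add: algebra_simps)

lemma ring_R: "ring R"
  using cring_R by (rule cring.axioms(1))

lemma ideal_iff:
  "ideal I R \<longleftrightarrow> I \<subseteq> carrier R \<and> 0 \<in> I \<and> (\<forall>f\<in>I. \<forall>g\<in>I. f + g \<in> I)
     \<and> (\<forall>f\<in>carrier R. \<forall>g\<in>I. f * g \<in> I)" (is "_ \<longleftrightarrow> ?rhs")
proof
  assume "ideal I R"
  then interpret ideal I R .
  show ?rhs
    using a_subset additive_subgroup.zero_closed[OF is_additive_subgroup]
      additive_subgroup.a_closed[OF is_additive_subgroup] I_l_closed by simp
next
  assume I: ?rhs
  show "ideal I R"
  proof (rule idealI[OF ring_R])
    show "subgroup I (add_monoid R)"
    proof (rule group.subgroupI)
      show "Group.group (add_monoid R)"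
        using abelian_group.a_group ring.is_abelian_group ring_R by blast
      fix f assume f: "f \<in> I"
      then have fM: "Poly_Mapping.keys f \<subseteq> M" using I by auto
      have "inv\<^bsub>add_monoid R\<^esub> f = - f"
        by (rule group.inv_equality[OF \<open>Group.group (add_monoid R)\<close>])
           (use fM in \<open>simp_all add: uminus_carrier\<close>)
      moreover have "(-1 :: (int ^ 'm) \<Rightarrow>\<^sub>0 'k) \<in> carrier R"
        using uminus_carrier[of 1] zero_in_M by simp
      then have "(-1) * f \<in> I"
        using I f by blast
      ultimately show "inv\<^bsub>add_monoid R\<^esub> f \<in> I" by simp
    qed (use I in auto)
  next
    fix f g assume "f \<in> I" "g \<in> carrier R"
    then show "g \<otimes>\<^bsub>R\<^esub> f \<in> I" "f \<otimes>\<^bsub>R\<^esub> g \<in> I"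
      using I by (simp_all add: mult.commute[of f])
  qed
qed

lemma ideal_closed:
  assumes "ideal I R"
  shows "f \<in> I \<Longrightarrow> Poly_Mapping.keys f \<subseteq> M" "0 \<in> I" "f \<in> I \<Longrightarrow> g \<in> I \<Longrightarrow> f + g \<in> I"
    and "Poly_Mapping.keys h \<subseteq> M \<Longrightarrow> f \<in> I \<Longrightarrow> h * f \<in> I"
    and "f \<in> I \<Longrightarrow> g \<in> I \<Longrightarrow> f - g \<in> I"
proof -
  have I: "I \<subseteq> carrier R" "0 \<in> I" "\<And>f g. f \<in> I \<Longrightarrow> g \<in> I \<Longrightarrow> f + g \<in> I"
    "\<And>f g. f \<in> carrier R \<Longrightarrow> g \<in> I \<Longrightarrow> f * g \<in> I"
    using assms unfolding ideal_iff by blast+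
  show "f \<in> I \<Longrightarrow> Poly_Mapping.keys f \<subseteq> M" "0 \<in> I" "f \<in> I \<Longrightarrow> g \<in> I \<Longrightarrow> f + g \<in> I"
    "Poly_Mapping.keys h \<subseteq> M \<Longrightarrow> f \<in> I \<Longrightarrow> h * f \<in> I"
    using I by auto
  show "f - g \<in> I" if "f \<in> I" "g \<in> I"
  proof -
    have "(-1) * g \<in> I" by (rule I(4)) (use that uminus_carrier[of 1] zero_in_M in auto)
    then show ?thesis using I(3)[of f "(-1) * g"] that by simp
  qed
qed

lemma ideal_Idl: "S \<subseteq> carrier R \<Longrightarrow> ideal (Idl\<^bsub>R\<^esub> S) R"
  by (rule ring.genideal_ideal[OF ring_R])

lemma Idl_superset: "S \<subseteq> carrier R \<Longrightarrow> S \<subseteq> Idl\<^bsub>R\<^esub> S"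
  by (rule ring.genideal_self[OF ring_R])

lemma Idl_minimal: "ideal I R \<Longrightarrow> S \<subseteq> I \<Longrightarrow> Idl\<^bsub>R\<^esub> S \<subseteq> I"
  by (rule ring.genideal_minimal[OF ring_R])

lemma nonzerodivisor_Quot_iff:
  assumes "ideal I R" "f \<in> carrier R"
  shows "nonzerodivisor (R Quot I) (I +>\<^bsub>R\<^esub> f) \<longleftrightarrow> (\<forall>h\<in>carrier R. f * h \<in> I \<longrightarrow> h \<in> I)"
proof -
  interpret ideal I R by fact
  have zero: "I +>\<^bsub>R\<^esub> g = I \<longleftrightarrow> g \<in> I" if "g \<in> carrier R" for g
    using a_coset_join1[OF _ that a_subgroup] a_coset_join2[OF that a_subgroup] by blast
  have fh: "f \<otimes>\<^bsub>R\<^esub> h \<in> carrier R" if "h \<in> carrier R" for h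
    using assms(2) that by (rule m_closed)
  have "nonzerodivisor (R Quot I) (I +>\<^bsub>R\<^esub> f) \<longleftrightarrow>
      (\<forall>h\<in>carrier R. I +>\<^bsub>R\<^esub> (f \<otimes>\<^bsub>R\<^esub> h) = I \<longrightarrow> I +>\<^bsub>R\<^esub> h = I)"
    unfolding nonzerodivisor_def FactRing_simps
    using assms(2) rcoset_mult_add by auto
  also have "\<dots> \<longleftrightarrow> (\<forall>h\<in>carrier R. f \<otimes>\<^bsub>R\<^esub> h \<in> I \<longrightarrow> h \<in> I)"
    by (intro ball_cong refl) (simp only: zero fh)
  finally show ?thesis by simp
qed

lemma regular_sequence_map_iff:
  "regular_sequence R (map g [1..<n]) \<longleftrightarrow>
     (\<forall>k\<in>{1..<n}. g k \<in> carrier R) \<and>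
     (\<forall>k\<in>{1..<n}. \<forall>h\<in>carrier R. g k * h \<in> Idl\<^bsub>R\<^esub> (g ` {1..<k}) \<longrightarrow> h \<in> Idl\<^bsub>R\<^esub> (g ` {1..<k})) \<and>
     Idl\<^bsub>R\<^esub> (g ` {1..<n}) \<noteq> carrier R"
proof (cases "\<forall>k\<in>{1..<n}. g k \<in> carrier R")
  case True
  have "(\<forall>i<n - 1. nonzerodivisor (R Quot Idl\<^bsub>R\<^esub> (set (take i (map g [1..<n]))))
           (Idl\<^bsub>R\<^esub> (set (take i (map g [1..<n]))) +>\<^bsub>R\<^esub> (map g [1..<n] ! i)))
     \<longleftrightarrow> (\<forall>k\<in>{1..<n}. nonzerodivisor (R Quot Idl\<^bsub>R\<^esub> (g ` {1..<k})) (Idl\<^bsub>R\<^esub> (g ` {1..<k}) +>\<^bsub>R\<^esub> g k))"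
    (is "(\<forall>i<n - 1. ?P i) \<longleftrightarrow> (\<forall>k\<in>{1..<n}. ?Q k)")
  proof -
    have "?P i \<longleftrightarrow> ?Q (Suc i)" if "i < n - 1" for i
    proof -
      have "take i [1..<n] = [1..<Suc i]" using that by simp
      then have "set (take i (map g [1..<n])) = g ` {1..<Suc i}"
        by (simp only: take_map set_map set_upt)
      moreover have "map g [1..<n] ! i = g (Suc i)" using that by simp
      ultimately show ?thesis by (simp only:)
    qed
    moreover have "{1..<n} = Suc ` {..<n - 1}"
      by (simp add: image_Suc_lessThan) auto
    ultimately show ?thesis by auto
  qed
  also have "\<dots> \<longleftrightarrow> (\<forall>k\<in>{1..<n}. \<forall>h\<in>carrier R.
      g k * h \<in> Idl\<^bsub>R\<^esub> (g ` {1..<k}) \<longrightarrow> h \<in> Idl\<^bsub>R\<^esub> (g ` {1..<k}))"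
  proof (intro ball_cong refl)
    fix k assume k: "k \<in> {1..<n}"
    have "g ` {1..<k} \<subseteq> carrier R" using True k by auto
    then show "?Q k \<longleftrightarrow> (\<forall>h\<in>carrier R. g k * h \<in> Idl\<^bsub>R\<^esub> (g ` {1..<k}) \<longrightarrow> h \<in> Idl\<^bsub>R\<^esub> (g ` {1..<k}))"
      using True k by (intro nonzerodivisor_Quot_iff ideal_Idl) auto
  qed
  finally show ?thesis
    using True unfolding regular_sequence_def Let_def by auto
next
  case False
  then show ?thesis unfolding regular_sequence_def by auto
qed

text \<open>A monomial ideal is determined by the exponents that it contains: \<open>a - x j \<in> M\<close> says that \<open>X^x\<^sub>j\<close>
divides \<open>X^a\<close> in \<open>K[M]\<close>.\<close>

lemma Idl_monomials:
  assumes "\<And>j. j \<in> S \<Longrightarrow> x j \<in> M"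
  shows "Idl\<^bsub>R\<^esub> ((\<lambda>i. monomial (x i)) ` S) = {f. \<forall>a\<in>Poly_Mapping.keys f. \<exists>j\<in>S. a - x j \<in> M}"
    (is "Idl\<^bsub>R\<^esub> ?G = ?J")
proof
  have G: "?G \<subseteq> carrier R" using assms by auto
  have J: "a \<in> M" if fJ: "f \<in> ?J" "a \<in> Poly_Mapping.keys f" for f :: "(int ^ 'm) \<Rightarrow>\<^sub>0 'k" and a
  proof -
    obtain j where "j \<in> S" "a - x j \<in> M" using fJ by blast
    then show ?thesis using add_in_M[of "a - x j" "x j"] assms by simp
  qed
  have "ideal ?J R"
    unfolding ideal_iff
  proof (intro conjI ballI)
    show "?J \<subseteq> carrier R" using J by auto
    show "0 \<in> ?J" by simp
  next
    fix f g assume "f \<in> ?J" "g \<in> ?J"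
    then show "f + g \<in> ?J" using Poly_Mapping.keys_add[of f g] by blast
  next
    fix f g assume f: "f \<in> carrier R" and g: "g \<in> ?J"
    show "f * g \<in> ?J"
    proof (intro CollectI ballI)
      fix c assume "c \<in> Poly_Mapping.keys (f * g)"
      then obtain a b where ab: "a \<in> Poly_Mapping.keys f" "b \<in> Poly_Mapping.keys g" "c = a + b"
        using Poly_Mapping.keys_mult[of f g] by blast
      then obtain j where j: "j \<in> S" "b - x j \<in> M" using g by blast
      have "c - x j = a + (b - x j)" by (simp add: ab)
      moreover have "a \<in> M" using f ab by auto
      ultimately show "\<exists>j\<in>S. c - x j \<in> M" using add_in_M j by metis
    qed
  qed
  moreover have "?G \<subseteq> ?J" using zero_in_M by (auto intro!: bexI)
  ultimately show "Idl\<^bsub>R\<^esub> ?G \<subseteq> ?J" by (rule Idl_minimal)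
  have I: "ideal (Idl\<^bsub>R\<^esub> ?G) R" using G by (rule ideal_Idl)
  show "?J \<subseteq> Idl\<^bsub>R\<^esub> ?G"
  proof
    fix f assume f: "f \<in> ?J"
    have "Poly_Mapping.single a (Poly_Mapping.lookup f a) \<in> Idl\<^bsub>R\<^esub> ?G" if a: "a \<in> Poly_Mapping.keys f" for a
    proof -
      obtain j where j: "j \<in> S" "a - x j \<in> M" using f a by blast
      have "Poly_Mapping.single (a - x j) (Poly_Mapping.lookup f a) * monomial (x j) \<in> Idl\<^bsub>R\<^esub> ?G"
        using Idl_superset[OF G] j by (intro ideal_closed(4)[OF I]) auto
      then show ?thesis by (simp add: monomial_def mult_single)
    qed
    then have "(\<Sum>a\<in>A. Poly_Mapping.single a (Poly_Mapping.lookup f a)) \<in> Idl\<^bsub>R\<^esub> ?G"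
      if "A \<subseteq> Poly_Mapping.keys f" for A
      using that by (induct A rule: infinite_finite_induct) (auto simp: ideal_closed(2,3)[OF I])
    from this[OF order_refl] show "f \<in> Idl\<^bsub>R\<^esub> ?G"
      by (simp flip: poly_mapping_eq_sum_single)
  qed
qed

text \<open>The kernel of \<open>K[M] \<rightarrow> K[\<int>\<^sup>m / U]\<close>; the coset of \<open>a\<close> is written as a comprehension.\<close>

definition balanced :: "(int ^ 'm) set \<Rightarrow> ((int ^ 'm) \<Rightarrow>\<^sub>0 'k) set" where
  "balanced U = {f \<in> carrier R. push (\<lambda>a. {b. b - a \<in> U}) f = 0}"

lemma coset_eq_iff:
  assumes "subgroup U lattice_group"
  shows "{c. c - a \<in> U} = {c. c - b \<in> U} \<longleftrightarrow> a - b \<in> (U :: (int ^ 'm) set)"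
proof
  assume "{c. c - a \<in> U} = {c. c - b \<in> U}"
  moreover have "a \<in> {c. c - a \<in> U}" using lattice_subgroup_closed(1)[OF assms] by simp
  ultimately show "a - b \<in> U" by blast
next
  assume ab: "a - b \<in> U"
  have "c - a \<in> U \<longleftrightarrow> c - b \<in> U" for c
    using lattice_subgroup_closed(2)[OF assms _ ab, of "c - a"]
      lattice_subgroup_closed(4)[OF assms _ ab, of "c - b"] by (auto simp only: diff_add_cancel diff_diff_eq2 add_diff_eq diff_add_eq)
  then show "{c. c - a \<in> U} = {c. c - b \<in> U}" by simp
qed

lemma ideal_balanced:
  assumes "subgroup U lattice_group"
  shows "ideal (balanced U) R"
  unfolding ideal_iff
proof (intro conjI ballI)
  fix f g assume fg: "f \<in> carrier R" "g \<in> balanced U"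
  have "push (\<lambda>a. {b. b - a \<in> U}) (f * g) = 0"
    by (rule push_mult_eq_0) (use fg(2) in \<open>simp_all add: coset_eq_iff[OF assms] balanced_def\<close>)
  then show "f * g \<in> balanced U"
    using fg mult_carrier[of f g] by (simp add: balanced_def)
next
  fix f g assume fg: "f \<in> balanced U" "g \<in> balanced U"
  then show "f + g \<in> balanced U"
    using add_carrier[of f g] by (simp add: balanced_def push_add)
qed (auto simp: balanced_def)

lemma monomial_notin_balanced: "monomial a \<notin> balanced U"
proof
  assume "monomial a \<in> balanced U"
  then have "Poly_Mapping.single {b. b - a \<in> U} (1 :: 'k) = 0" by (simp add: balanced_def monomial_def)
  then show False by (metis lookup_single_eq lookup_zero zero_neq_one)
qed

lemma single_one_eq_iff: "Poly_Mapping.single u (1 :: 'k) = Poly_Mapping.single v 1 \<longleftrightarrow> u = v"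
  by (metis lookup_single_eq lookup_single_not_eq zero_neq_one)

lemma binomial_in_balanced_iff:
  assumes "subgroup U lattice_group" "a \<in> M" "b \<in> M"
  shows "monomial a - monomial b \<in> balanced U \<longleftrightarrow> a - b \<in> U"
  using diff_carrier[of "monomial a" "monomial b"] assms(2,3)
  by (simp add: balanced_def push_diff monomial_def single_one_eq_iff coset_eq_iff[OF assms(1)])

text \<open>The first \<open>N\<close> multiples of an element of order at least \<open>N\<close> lie in different cosets, so the
coset of \<open>c\<close> has coefficient sum \<open>1\<close>, in every characteristic.\<close>

lemma geometric_sum_notin_balanced:
  assumes U: "subgroup U lattice_group" and "N > 0"
    and N: "\<And>k. 0 < k \<Longrightarrow> k < N \<Longrightarrow> int k *s g \<notin> U"
  shows "(\<Sum>i<N. monomial (c + int i *s g)) \<notin> balanced U"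
proof
  let ?\<kappa> = "\<lambda>a. {b. b - a \<in> U}"
  assume "(\<Sum>i<N. monomial (c + int i *s g)) \<in> balanced U"
  then have "push ?\<kappa> (\<Sum>i<N. monomial (c + int i *s g) :: (int ^ 'm) \<Rightarrow>\<^sub>0 'k) = 0"
    by (simp add: balanced_def)
  then have "(\<Sum>i<N. Poly_Mapping.single (?\<kappa> (c + int i *s g)) (1 :: 'k)) = 0"
    by (simp add: push_sum monomial_def)
  then have "Poly_Mapping.lookup (\<Sum>i<N. Poly_Mapping.single (?\<kappa> (c + int i *s g)) (1 :: 'k)) (?\<kappa> c) = 0"
    by simp
  moreover have "Poly_Mapping.lookup (Poly_Mapping.single (?\<kappa> (c + int i *s g)) (1 :: 'k)) (?\<kappa> c)
      = (if i = 0 then 1 else 0)" if "i < N" for i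
    unfolding lookup_single when_def coset_eq_iff[OF U]
    using N[of i] that lattice_subgroup_closed(1)[OF U] by auto
  ultimately have "(\<Sum>i<N. if i = 0 then 1 else 0 :: 'k) = 0"
    by (simp add: lookup_sum cong: sum.cong_simp)
  then show False using \<open>N > 0\<close> by simp
qed

text \<open>A support element \<open>a\<close> of a balanced \<open>f\<close> shares its coset with another support element \<open>b\<close>.
Subtracting a multiple of \<open>X^a - X^b\<close> removes \<open>a\<close> and enlarges the support nowhere, so induction on
the size of the support applies.\<close>

lemma balanced_subset_ideal:
  assumes I: "ideal I R" and U: "subgroup U lattice_group"
    and binom: "\<And>a b. a \<in> M \<Longrightarrow> b \<in> M \<Longrightarrow> a - b \<in> U \<Longrightarrow> monomial a - monomial b \<in> I"
  shows "balanced U \<subseteq> I"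
proof
  fix f assume "f \<in> balanced U"
  then show "f \<in> I"
  proof (induct "card (Poly_Mapping.keys f)" arbitrary: f rule: less_induct)
    case less
    show ?case
    proof (cases "f = 0")
      case True
      then show ?thesis using ideal_closed(2)[OF I] by simp
    next
      case False
      then obtain a where a: "a \<in> Poly_Mapping.keys f" by (metis ex_in_conv keys_eq_empty)
      have fM: "Poly_Mapping.keys f \<subseteq> M" and f0: "push (\<lambda>a. {b. b - a \<in> U}) f = 0"
        using less(2) by (auto simp: balanced_def)
      let ?F = "{b. b \<in> Poly_Mapping.keys f \<and> {c. c - b \<in> U} = {c. c - a \<in> U}}"
      have "(\<Sum>b\<in>?F. Poly_Mapping.lookup f b) = 0"
        using f0 a unfolding push_eq_0_iff by blast
      moreover have "Poly_Mapping.lookup f a \<noteq> 0" using a by (simp add: in_keys_iff)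
      ultimately have "?F \<noteq> {a}" by auto
      then obtain b where b: "b \<in> Poly_Mapping.keys f" "b \<noteq> a" "b - a \<in> U"
        using a coset_eq_iff[OF U] by blast
      define g where "g = Poly_Mapping.single 0 (Poly_Mapping.lookup f a) * (monomial a - monomial b)"
      have ab: "a \<in> M" "b \<in> M" using a b fM by auto
      have "a - b \<in> U" using lattice_subgroup_closed(3)[OF U b(3)] by simp
      then have "monomial a - monomial b \<in> I" "monomial a - monomial b \<in> balanced U"
        using binom ab binomial_in_balanced_iff[OF U] by auto
      moreover have "Poly_Mapping.keys (Poly_Mapping.single 0 (Poly_Mapping.lookup f a)) \<subseteq> M"
        using zero_in_M by auto
      ultimately have gI: "g \<in> I" and gQ: "g \<in> balanced U"
        unfolding g_def using ideal_closed(4)[OF I] ideal_closed(4)[OF ideal_balanced[OF U]] by blast+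
      have g: "Poly_Mapping.lookup g c = (if c = a then Poly_Mapping.lookup f a
          else if c = b then - Poly_Mapping.lookup f a else 0)" for c
        using b(2) by (auto simp: g_def monomial_def right_diff_distrib mult_single lookup_minus lookup_single when_def)
      have "Poly_Mapping.keys (f - g) \<subseteq> Poly_Mapping.keys f - {a}"
        using b(1) by (auto simp: in_keys_iff lookup_minus g split: if_splits)
      then have "card (Poly_Mapping.keys (f - g)) < card (Poly_Mapping.keys f)"
        using a by (meson Diff_subset card_Diff1_less card_mono finite_Diff finite_keys le_less_trans)
      moreover have "f - g \<in> balanced U" using ideal_closed(5)[OF ideal_balanced[OF U] less(2) gQ] .
      ultimately have "f - g \<in> I" by (rule less(1))
      then show ?thesis using ideal_closed(3)[OF I _ gI] by fastforce
    qed
  qed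
qed

text \<open>The group algebra of an ordered abelian group is a domain, because leading terms multiply. Thus
the kernel is prime as soon as the congruence modulo \<open>U\<close> is induced by a homomorphism to an ordered
group.\<close>

lemma primeideal_balanced:
  fixes \<phi> :: "int ^ 'm \<Rightarrow> 'o::linordered_ab_group_add"
  assumes U: "subgroup U lattice_group"
    and add: "\<And>a b. \<phi> (a + b) = \<phi> a + \<phi> b"
    and ker: "\<And>a b. a \<in> M \<Longrightarrow> b \<in> M \<Longrightarrow> a - b \<in> U \<longleftrightarrow> \<phi> a = \<phi> b"
  shows "primeideal (balanced U) R"
proof -
  have Q: "f \<in> balanced U \<longleftrightarrow> push \<phi> f = 0" if "f \<in> carrier R" for f
    unfolding balanced_def using that ker
    by (simp add: subset_iff coset_eq_iff[OF U] push_eq_0_cong[of f "\<lambda>a. {b. b - a \<in> U}" \<phi>])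
  show ?thesis
  proof (rule primeidealI[OF ideal_balanced[OF U] cring_R])
    have "(1 :: (int ^ 'm) \<Rightarrow>\<^sub>0 'k) \<notin> balanced U" using monomial_notin_balanced[of 0] by (simp add: monomial_0)
    moreover have "(1 :: (int ^ 'm) \<Rightarrow>\<^sub>0 'k) \<in> carrier R" using zero_in_M by simp
    ultimately show "carrier R \<noteq> balanced U" by blast
  next
    fix f g assume fg: "f \<in> carrier R" "g \<in> carrier R" "f \<otimes>\<^bsub>R\<^esub> g \<in> balanced U"
    then have "push \<phi> f * push \<phi> g = 0"
      using Q[of "f * g"] mult_carrier[of f g] by (simp add: push_mult add)
    then show "f \<in> balanced U \<or> g \<in> balanced U"
      using Q fg by simp
  qed
qed

end


section \<open>Dickson's lemma for affine monoids\<close>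

lemma nat_sequence_mono_subsequence:
  fixes f :: "nat \<Rightarrow> nat"
  obtains h :: "nat \<Rightarrow> nat" where "strict_mono h" "mono (\<lambda>k. f (h k))"
proof -
  obtain g :: "nat \<Rightarrow> nat" where g: "strict_mono g" "monoseq (\<lambda>k. f (g k))"
    using seq_monosub[of f] by blast
  show thesis
  proof (cases "\<forall>m. \<forall>n\<ge>m. f (g m) \<le> f (g n)")
    case True
    then show thesis using that[OF g(1)] by (simp add: mono_def)
  next
    case False
    then have dec: "f (g n) \<le> f (g m)" if "m \<le> n" for m n
      using g(2) that unfolding monoseq_def by blast
    obtain n0 where n0: "\<And>n. f (g n0) \<le> f (g n)"
      using ex_has_least_nat[of "\<lambda>_. True" _ "\<lambda>n. f (g n)"] by auto
    have "f (g (n0 + k)) = f (g n0)" for k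
      using dec[of n0 "n0 + k"] n0[of "n0 + k"] by simp
    then have "mono (\<lambda>k. f (g (n0 + k)))" by (simp add: mono_def)
    moreover have "strict_mono (\<lambda>k. g (n0 + k))"
      using g(1) by (simp add: strict_mono_def)
    ultimately show thesis using that by blast
  qed
qed

lemma family_mono_subsequence:
  fixes f :: "nat \<Rightarrow> 's \<Rightarrow> nat"
  assumes "finite S"
  shows "\<exists>h::nat \<Rightarrow> nat. strict_mono h \<and> (\<forall>s\<in>S. mono (\<lambda>k. f (h k) s))"
  using assms
proof induct
  case empty
  show ?case by (intro exI[of _ "\<lambda>k. k"]) (simp add: strict_mono_def)
next
  case (insert s S)
  then obtain g :: "nat \<Rightarrow> nat" where g: "strict_mono g" "\<forall>s\<in>S. mono (\<lambda>k. f (g k) s)" by blast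
  obtain h :: "nat \<Rightarrow> nat" where h: "strict_mono h" "mono (\<lambda>k. f (g (h k)) s)"
    using nat_sequence_mono_subsequence[of "\<lambda>k. f (g k) s"] by blast
  have "strict_mono (\<lambda>k. g (h k))" using g(1) h(1) by (simp add: strict_mono_def)
  moreover have "mono (\<lambda>k. f (g (h k)) t)" if "t \<in> S" for t
    using g(2) that h(1) by (simp add: mono_def strict_mono_less_eq)
  ultimately show ?case using h(2) by blast
qed

lemma affine_monoid_submonoid:
  assumes "affine_monoid M"
  shows "submonoid M lattice_group"
proof -
  obtain S where "M = (\<lambda>N. submonoid N lattice_group) hull S"
    using assms unfolding affine_monoid_def by blast
  moreover have "submonoid ((\<lambda>N. submonoid N lattice_group) hull S) lattice_group"
    by (rule hull_in) (auto simp: submonoid_lattice_iff)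
  ultimately show ?thesis by simp
qed

lemma affine_monoid_combination:
  assumes "affine_monoid (M :: (int ^ 'm) set)"
  obtains S where "finite S" "S \<subseteq> M" "\<And>a. a \<in> M \<Longrightarrow> \<exists>c::int ^ 'm \<Rightarrow> nat. a = (\<Sum>s\<in>S. int (c s) *s s)"
proof -
  obtain S where S: "finite S" "M = (\<lambda>N. submonoid N lattice_group) hull S"
    using assms unfolding affine_monoid_def by blast
  let ?T = "range (\<lambda>c::int ^ 'm \<Rightarrow> nat. \<Sum>s\<in>S. int (c s) *s s)"
  have "submonoid ?T lattice_group"
    unfolding submonoid_lattice_iff
  proof (intro conjI ballI)
    show "0 \<in> ?T" by (rule range_eqI[of _ _ "\<lambda>_. 0"]) simp
  next
    fix a b assume "a \<in> ?T" "b \<in> ?T"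
    then obtain c d where "a = (\<Sum>s\<in>S. int (c s) *s s)" "b = (\<Sum>s\<in>S. int (d s) *s s)" by blast
    then show "a + b \<in> ?T"
      by (intro range_eqI[of _ _ "\<lambda>s. c s + d s"]) (simp add: sum.distrib int_lattice.scale_left_distrib)
  qed
  moreover have "S \<subseteq> ?T"
  proof
    fix s assume "s \<in> S"
    have "(\<Sum>t\<in>S. int (if t = s then 1 else 0) *s t) = (\<Sum>t\<in>S. if t = s then t else 0)"
      by (intro sum.cong) auto
    also have "\<dots> = s" using S(1) \<open>s \<in> S\<close> by simp
    finally show "s \<in> ?T" by (intro range_eqI[of _ _ "\<lambda>t. if t = s then 1 else 0"]) simp
  qed
  ultimately have "M \<subseteq> ?T" unfolding S(2) by (intro hull_minimal)
  moreover have "S \<subseteq> M" unfolding S(2) by (rule hull_subset)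
  ultimately show thesis using that[OF S(1)] by blast
qed

text \<open>Divisibility in a finitely generated commutative monoid is a well-quasi-order: among the
coefficient vectors over the generators some two comparable ones occur in increasing order.\<close>

lemma affine_monoid_wqo:
  assumes "affine_monoid (M :: (int ^ 'm) set)" and "\<And>k::nat. m k \<in> M"
  obtains k l where "k < l" "m l - m k \<in> M"
proof -
  obtain S where S: "finite S" "S \<subseteq> M"
    and ex: "\<And>a. a \<in> M \<Longrightarrow> \<exists>c::int ^ 'm \<Rightarrow> nat. a = (\<Sum>s\<in>S. int (c s) *s s)"
    using affine_monoid_combination[OF assms(1)] by blast
  have "\<forall>k. \<exists>c::int ^ 'm \<Rightarrow> nat. m k = (\<Sum>s\<in>S. int (c s) *s s)" using ex assms(2) by blast
  then obtain c :: "nat \<Rightarrow> int ^ 'm \<Rightarrow> nat" where c: "\<And>k. m k = (\<Sum>s\<in>S. int (c k s) *s s)"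
    by metis
  obtain h :: "nat \<Rightarrow> nat" where h: "strict_mono h" "\<And>s. s \<in> S \<Longrightarrow> mono (\<lambda>k. c (h k) s)"
    using family_mono_subsequence[OF S(1), of c] by blast
  have M: "0 \<in> M" "\<And>a b. a \<in> M \<Longrightarrow> b \<in> M \<Longrightarrow> a + b \<in> M"
    using affine_monoid_submonoid[OF assms(1)] by (auto simp: submonoid_lattice_iff)
  have scale: "int k *s a \<in> M" if "a \<in> M" for k a
    using that by (induct k) (auto simp: M int_lattice.scale_left_distrib)
  have sum: "sum f A \<in> M" if "\<And>s. s \<in> A \<Longrightarrow> f s \<in> M" for f :: "int ^ 'm \<Rightarrow> int ^ 'm" and A
    using that by (induct A rule: infinite_finite_induct) (auto simp: M)
  have "m (h 1) - m (h 0) = (\<Sum>s\<in>S. int (c (h 1) s - c (h 0) s) *s s)"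
    unfolding c sum_subtractf[symmetric]
  proof (rule sum.cong[OF refl])
    fix s assume "s \<in> S"
    then have "c (h 0) s \<le> c (h 1) s" using h(2)[of s] by (simp add: mono_def)
    then show "int (c (h 1) s) *s s - int (c (h 0) s) *s s = int (c (h 1) s - c (h 0) s) *s s"
      by (simp add: of_nat_diff int_lattice.scale_left_diff_distrib)
  qed
  also have "\<dots> \<in> M" using S(2) by (intro sum scale) blast
  finally have "m (h 1) - m (h 0) \<in> M" .
  moreover have "h 0 < h 1" using h(1) by (simp add: strict_mono_def)
  ultimately show thesis by (rule that[rotated])
qed

section \<open>Ranks and integer linear systems\<close>

text \<open>Fraction-free Gaussian elimination: an equation with a nonzero coefficient at \<open>p\<close> expresses the
unknown at \<open>p\<close> by the others, after multiplication by that coefficient.\<close>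

lemma homogeneous_system_nontrivial:
  fixes a :: "'e \<Rightarrow> 'i \<Rightarrow> int"
  assumes "finite E" "finite I" "card E < card I"
  shows "\<exists>c. (\<exists>i\<in>I. c i \<noteq> 0) \<and> (\<forall>e\<in>E. (\<Sum>i\<in>I. a e i * c i) = 0)"
  using assms
proof (induct E arbitrary: I a rule: finite_induct)
  case empty
  then have "I \<noteq> {}" by auto
  then show ?case by (intro exI[of _ "\<lambda>_. 1"]) auto
next
  case (insert e E)
  show ?case
  proof (cases "\<forall>i\<in>I. a e i = 0")
    case True
    have "card E < card I" using insert by simp
    from insert(3)[OF insert(4) this, of a] obtain c
      where "\<exists>i\<in>I. c i \<noteq> 0" "\<forall>e\<in>E. (\<Sum>i\<in>I. a e i * c i) = 0" by blast
    moreover have "(\<Sum>i\<in>I. a e i * c i) = 0" using True by (intro sum.neutral) simp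
    ultimately show ?thesis by blast
  next
    case False
    then obtain p where p: "p \<in> I" "a e p \<noteq> 0" by blast
    let ?J = "I - {p}"
    have J: "finite ?J" "card E < card ?J" using insert p by auto
    from insert(3)[OF this, of "\<lambda>e' i. a e p * a e' i - a e' p * a e i"] obtain c
      where c: "\<exists>i\<in>?J. c i \<noteq> 0"
        "\<And>e'. e' \<in> E \<Longrightarrow> (\<Sum>i\<in>?J. (a e p * a e' i - a e' p * a e i) * c i) = 0" by blast
    \<comment> \<open>Equation \<open>e\<close> determines the value at the pivot up to the factor \<open>a e p\<close>.\<close>
    define s where "s = (\<Sum>i\<in>?J. a e i * c i)"
    define d where "d = (\<lambda>i. if i = p then - s else a e p * c i)"
    have d: "(\<Sum>i\<in>I. a e' i * d i) = a e p * (\<Sum>i\<in>?J. a e' i * c i) - a e' p * s" for e'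
    proof -
      have "(\<Sum>i\<in>I. a e' i * d i) = a e' p * d p + (\<Sum>i\<in>?J. a e' i * d i)"
        using insert(4) p(1) by (simp add: sum.remove)
      also have "(\<Sum>i\<in>?J. a e' i * d i) = (\<Sum>i\<in>?J. a e p * (a e' i * c i))"
        by (intro sum.cong) (auto simp: d_def)
      finally show ?thesis by (simp add: d_def sum_distrib_left)
    qed
    have "(\<Sum>i\<in>I. a e' i * d i) = 0" if "e' \<in> insert e E" for e'
    proof (cases "e' = e")
      case True
      then show ?thesis by (simp add: d s_def)
    next
      case False
      then have "(\<Sum>i\<in>?J. a e p * (a e' i * c i) - a e' p * (a e i * c i)) = 0"
        using c(2)[of e'] that by (simp add: algebra_simps)
      then show ?thesis by (simp add: d s_def sum_subtractf sum_distrib_left)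
    qed
    moreover have "\<exists>i\<in>I. d i \<noteq> 0"
    proof -
      obtain i where "i \<in> ?J" "c i \<noteq> 0" using c(1) by blast
      then show ?thesis using p(2) by (intro bexI[of _ i]) (auto simp: d_def)
    qed
    ultimately show ?thesis by blast
  qed
qed

text \<open>The integral substitute for the exchange lemma. The factor \<open>N\<close> stands for a common denominator:
rationally, the elements of \<open>B\<close> lie in the span of the \<open>v e\<close>.\<close>

lemma dependent_if_few_generators:
  fixes B :: "(int ^ 'm) set" and v :: "'e \<Rightarrow> int ^ 'm"
  assumes "finite B" "finite E" "card E < card B" "N \<noteq> 0"
    and "\<And>b. b \<in> B \<Longrightarrow> \<exists>a. N *s b = (\<Sum>e\<in>E. a e *s v e)"
  shows "int_lattice.dependent B"
proof -
  obtain a where a: "\<And>b. b \<in> B \<Longrightarrow> N *s b = (\<Sum>e\<in>E. a b e *s v e)"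
    using assms(5) by metis
  obtain c where c: "\<exists>b\<in>B. c b \<noteq> 0" "\<And>e. e \<in> E \<Longrightarrow> (\<Sum>b\<in>B. a b e * c b) = 0"
    using homogeneous_system_nontrivial[OF assms(2,1,3), of "\<lambda>e b. a b e"] by blast
  have "(\<Sum>b\<in>B. (N * c b) *s b) = (\<Sum>b\<in>B. c b *s (N *s b))"
    by (simp add: mult.commute)
  also have "\<dots> = (\<Sum>b\<in>B. \<Sum>e\<in>E. (a b e * c b) *s v e)"
    by (intro sum.cong refl) (simp add: a int_lattice.scale_sum_right mult.commute)
  also have "\<dots> = (\<Sum>e\<in>E. (\<Sum>b\<in>B. a b e * c b) *s v e)"
    by (subst sum.swap) (simp add: int_lattice.scale_sum_left)
  also have "\<dots> = 0" using c(2) by (intro sum.neutral) simp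
  finally have "(\<Sum>b\<in>B. (N * c b) *s b) = 0" .
  moreover have "\<exists>b\<in>B. N * c b \<noteq> 0" using c(1) assms(4) by simp
  ultimately show ?thesis
    unfolding int_lattice.dependent_finite[OF assms(1)] by (intro exI[of _ "\<lambda>b. N * c b"] conjI)
qed

text \<open>The group generated by all differences of members of the family.\<close>

definition zero_sum_span :: "'i set \<Rightarrow> ('i \<Rightarrow> int ^ 'm) \<Rightarrow> (int ^ 'm) set" where
  "zero_sum_span A x = {(\<Sum>i\<in>A. c i *s x i) |c. (\<Sum>i\<in>A. c i) = 0}"

definition int_affine_independent :: "'i set \<Rightarrow> ('i \<Rightarrow> int ^ 'm) \<Rightarrow> bool" where
  "int_affine_independent A x \<longleftrightarrow>
     (\<forall>c. (\<Sum>i\<in>A. c i) = 0 \<longrightarrow> (\<Sum>i\<in>A. c i *s x i) = 0 \<longrightarrow> (\<forall>i\<in>A. c i = 0))"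

lemma subgroup_zero_sum_span: "subgroup (zero_sum_span A x) lattice_group"
  unfolding subgroup_lattice_iff
proof (intro conjI ballI)
  show "0 \<in> zero_sum_span A x"
    unfolding zero_sum_span_def by (intro CollectI exI[of _ "\<lambda>_. 0"]) simp
next
  fix a b assume "a \<in> zero_sum_span A x" "b \<in> zero_sum_span A x"
  then obtain c d where "a = (\<Sum>i\<in>A. c i *s x i)" "b = (\<Sum>i\<in>A. d i *s x i)"
    "(\<Sum>i\<in>A. c i) = 0" "(\<Sum>i\<in>A. d i) = 0"
    unfolding zero_sum_span_def by blast
  then show "a + b \<in> zero_sum_span A x"
    unfolding zero_sum_span_def
    by (intro CollectI exI[of _ "\<lambda>i. c i + d i"]) (simp add: sum.distrib int_lattice.scale_left_distrib)
next
  fix a assume "a \<in> zero_sum_span A x"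
  then obtain c where "a = (\<Sum>i\<in>A. c i *s x i)" "(\<Sum>i\<in>A. c i) = 0"
    unfolding zero_sum_span_def by blast
  then show "- a \<in> zero_sum_span A x"
    unfolding zero_sum_span_def
    by (intro CollectI exI[of _ "\<lambda>i. - c i"]) (simp add: sum_negf)
qed

lemma sum_scale_indicator:
  fixes x :: "'i \<Rightarrow> int ^ 'm"
  assumes "finite A" "i \<in> A"
  shows "(\<Sum>k\<in>A. (if k = i then r else 0) *s x k) = r *s x i"
proof -
  have "(\<Sum>k\<in>A. (if k = i then r else 0) *s x k) = (\<Sum>k\<in>A. if k = i then r *s x k else 0)"
    by (intro sum.cong) auto
  then show ?thesis using assms by simp
qed

lemma diff_in_zero_sum_span:
  assumes "finite A" "i \<in> A" "j \<in> A"
  shows "x i - x j \<in> zero_sum_span A x"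
proof -
  let ?c = "\<lambda>k. (if k = i then 1 else 0) - (if k = j then 1 else (0::int))"
  have "(\<Sum>k\<in>A. ?c k *s x k) = x i - x j"
    unfolding int_lattice.scale_left_diff_distrib sum_subtractf
    by (simp add: sum_scale_indicator assms)
  moreover have "(\<Sum>k\<in>A. ?c k) = 0" unfolding sum_subtractf using assms by simp
  ultimately show ?thesis unfolding zero_sum_span_def by (intro CollectI exI[of _ ?c]) simp
qed

text \<open>Relative to a base point \<open>p\<close>, the zero-sum combinations are arbitrary combinations of the
remaining \<open>card A - 1\<close> differences.\<close>

lemma zero_sum_recenter:
  fixes x :: "'i \<Rightarrow> int ^ 'm"
  assumes "finite A" "p \<in> A" "(\<Sum>i\<in>A. c i) = 0"
  shows "(\<Sum>i\<in>A. c i *s x i) = (\<Sum>i\<in>A - {p}. c i *s (x i - x p))"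
proof -
  have "(\<Sum>i\<in>A - {p}. c i *s (x i - x p)) = (\<Sum>i\<in>A. c i *s (x i - x p))"
    using assms(1,2) by (simp add: sum.remove[of A p])
  also have "\<dots> = (\<Sum>i\<in>A. c i *s x i) - (\<Sum>i\<in>A. c i) *s x p"
    by (simp add: int_lattice.scale_right_diff_distrib sum_subtractf int_lattice.scale_sum_left)
  finally show ?thesis using assms(3) by simp
qed

lemma generate_consecutive_differences:
  fixes x :: "nat \<Rightarrow> int ^ 'm"
  assumes "n \<ge> 1"
  shows "generate lattice_group ((\<lambda>i. x i - x (i + 1)) ` {1..<n}) = zero_sum_span {1..n} x"
    (is "?G = _")
proof
  show "?G \<subseteq> zero_sum_span {1..n} x"
    by (intro generate_lattice_minimal subgroup_zero_sum_span image_subsetI diff_in_zero_sum_span) auto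
  have G: "subgroup ?G lattice_group" by (rule subgroup_generate_lattice)
  have diff: "x 1 - x k \<in> ?G" if "1 \<le> k" "k \<le> n" for k
    using that
  proof (induct k rule: nat_induct_at_least)
    case base
    show ?case using lattice_subgroup_closed(1)[OF G] by simp
  next
    case (Suc k)
    have "x k - x (k + 1) \<in> ?G" using Suc by (intro generate.incl) auto
    then have "(x 1 - x k) + (x k - x (k + 1)) \<in> ?G"
      using Suc by (intro lattice_subgroup_closed(2)[OF G]) auto
    then show ?case by simp
  qed
  show "zero_sum_span {1..n} x \<subseteq> ?G"
  proof
    fix u assume "u \<in> zero_sum_span {1..n} x"
    then obtain c where c: "u = (\<Sum>i\<in>{1..n}. c i *s x i)" "(\<Sum>i\<in>{1..n}. c i) = 0"
      unfolding zero_sum_span_def by blast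
    have "u = (\<Sum>i\<in>{1..n} - {1}. c i *s (x i - x 1))"
      unfolding c(1) by (rule zero_sum_recenter) (use assms c(2) in auto)
    moreover have "x i - x 1 \<in> ?G" if i: "i \<in> {1..n} - {1}" for i
      using lattice_subgroup_closed(3)[OF G diff[of i]] i by simp
    then have "(\<Sum>i\<in>{1..n} - {1}. c i *s (x i - x 1)) \<in> ?G"
      by (intro lattice_subgroup_sum[OF G] lattice_subgroup_scale[OF G])
    ultimately show "u \<in> ?G" by simp
  qed
qed

text \<open>The differences \<open>x i - x p\<close> generate, so the rank is at most \<open>card A - 1\<close>, and it is attained by
them if they are independent. Conversely, a relation with coefficient \<open>c k \<noteq> 0\<close> places the multiple
by \<open>c k\<close> of the whole group into the span of the other differences, which are one fewer.\<close>

lemma lattice_rank_zero_sum_span: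
  fixes x :: "'i \<Rightarrow> int ^ 'm"
  assumes A: "finite A" "A \<noteq> {}"
  shows "lattice_rank (zero_sum_span A x) = card A - 1 \<longleftrightarrow> int_affine_independent A x"
proof -
  obtain p where p: "p \<in> A" using A(2) by blast
  let ?U = "zero_sum_span A x" and ?E = "A - {p}"
  let ?v = "\<lambda>i. x i - x p"
  let ?ranks = "{card B |B. B \<subseteq> ?U \<and> finite B \<and> int_lattice.independent B}"
  have card_E: "card ?E = card A - 1" using p A(1) by simp
  have U: "\<exists>a. b = (\<Sum>i\<in>?E. a i *s ?v i)" if b: "b \<in> ?U" for b
  proof -
    obtain c where c: "b = (\<Sum>i\<in>A. c i *s x i)" "(\<Sum>i\<in>A. c i) = 0"
      using b unfolding zero_sum_span_def by auto
    show ?thesis using zero_sum_recenter[OF A(1) p c(2), of x] c(1) by (intro exI[of _ c]) simp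
  qed
  have bound: "card B \<le> card ?E" if "B \<subseteq> ?U" "finite B" "int_lattice.independent B" for B
  proof (rule ccontr)
    assume "\<not> card B \<le> card ?E"
    then have "int_lattice.dependent B"
      using that(1) U by (intro dependent_if_few_generators[of B ?E 1 ?v] that(2)) (use A(1) in auto)
    then show False using that(3) by simp
  qed
  then have fin: "finite ?ranks" by (intro finite_subset[of ?ranks "{..card ?E}"]) auto
  have "card ({} :: (int ^ 'm) set) \<in> ?ranks"
    by (intro CollectI exI[of _ "{}"]) (simp add: int_lattice.independent_empty)
  then have "Max ?ranks \<in> ?ranks" by (intro Max_in fin) blast
  show ?thesis
  proof
    assume "lattice_rank ?U = card A - 1"
    then obtain B where B: "B \<subseteq> ?U" "finite B" "int_lattice.independent B" "card B = card A - 1"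
      using \<open>Max ?ranks \<in> ?ranks\<close> unfolding lattice_rank_def by auto
    show "int_affine_independent A x"
      unfolding int_affine_independent_def
    proof (intro allI impI)
      fix c assume c: "(\<Sum>i\<in>A. c i) = 0" "(\<Sum>i\<in>A. c i *s x i) = 0"
      have E0: "c k = 0" if k: "k \<in> ?E" for k
      proof (rule ccontr)
        assume ck: "c k \<noteq> 0"
        have rel: "(\<Sum>i\<in>?E - {k}. c i *s ?v i) = - (c k *s ?v k)"
        proof -
          have "(\<Sum>i\<in>?E. c i *s ?v i) = 0" using zero_sum_recenter[OF A(1) p c(1), of x] c(2) by simp
          then show ?thesis using k A(1) by (simp add: sum.remove[of ?E k] eq_neg_iff_add_eq_0 add.commute)
        qed
        have "\<exists>a. c k *s b = (\<Sum>i\<in>?E - {k}. a i *s ?v i)" if b: "b \<in> B" for b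
        proof -
          obtain a where a: "b = (\<Sum>i\<in>?E. a i *s ?v i)" using U B(1) b by blast
          have "c k *s b = (\<Sum>i\<in>?E. (c k * a i) *s ?v i)"
            by (simp add: a int_lattice.scale_sum_right)
          also have "\<dots> = (c k * a k) *s ?v k + (\<Sum>i\<in>?E - {k}. (c k * a i) *s ?v i)"
            using k A(1) by (simp add: sum.remove[of ?E k])
          also have "(c k * a k) *s ?v k = a k *s (c k *s ?v k)" by (simp add: mult.commute)
          also have "c k *s ?v k = - (\<Sum>i\<in>?E - {k}. c i *s ?v i)" using rel by simp
          also have "a k *s (- (\<Sum>i\<in>?E - {k}. c i *s ?v i)) + (\<Sum>i\<in>?E - {k}. (c k * a i) *s ?v i)
              = (\<Sum>i\<in>?E - {k}. (c k * a i - a k * c i) *s ?v i)"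
            by (simp add: int_lattice.scale_sum_right int_lattice.scale_left_diff_distrib sum_subtractf)
          finally show ?thesis by (rule exI[of _ "\<lambda>i. c k * a i - a k * c i"])
        qed
        moreover have "card (?E - {k}) < card B" using k A(1) card_E B(4)
          by (metis card_Diff1_less finite_Diff)
        ultimately have "int_lattice.dependent B"
          using ck A(1) B(2) by (intro dependent_if_few_generators[of B "?E - {k}" "c k" ?v]) auto
        then show False using B(3) by simp
      qed
      moreover have "c p = 0"
      proof -
        have "(\<Sum>i\<in>?E. c i) = 0" using E0 by (intro sum.neutral) blast
        then show ?thesis using c(1) p A(1) by (simp add: sum.remove[of A p])
      qed
      ultimately show "\<forall>i\<in>A. c i = 0" by blast
    qed
  next
    assume indep: "int_affine_independent A x"
    have zero: "a i = 0" if sum0: "(\<Sum>i\<in>?E. a i *s ?v i) = 0" and i: "i \<in> ?E" for a i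
    proof -
      let ?c = "\<lambda>i. if i = p then - (\<Sum>i\<in>?E. a i) else a i"
      have c: "(\<Sum>i\<in>A. ?c i) = 0"
      proof -
        have "(\<Sum>i\<in>?E. ?c i) = (\<Sum>i\<in>?E. a i)" by (intro sum.cong) auto
        then show ?thesis using p A(1) by (simp add: sum.remove[of A p])
      qed
      have "(\<Sum>i\<in>A. ?c i *s x i) = (\<Sum>i\<in>?E. ?c i *s ?v i)"
        by (rule zero_sum_recenter[OF A(1) p c])
      also have "\<dots> = (\<Sum>i\<in>?E. a i *s ?v i)" by (intro sum.cong) auto
      finally have "(\<Sum>i\<in>A. ?c i *s x i) = 0" using sum0 by simp
      then have all0: "\<forall>i\<in>A. ?c i = 0" using indep c unfolding int_affine_independent_def by blast
      have "i \<in> A" "i \<noteq> p" using i by auto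
      then show ?thesis using bspec[OF all0, of i] by (simp only: if_False)
    qed
    have inj: "inj_on ?v ?E"
    proof (rule inj_onI, rule ccontr)
      fix i j assume ij: "i \<in> ?E" "j \<in> ?E" "?v i = ?v j" "i \<noteq> j"
      let ?a = "\<lambda>k. (if k = i then 1 else 0) - (if k = j then 1 else (0::int))"
      have "(\<Sum>k\<in>?E. ?a k *s ?v k) = ?v i - ?v j"
        unfolding int_lattice.scale_left_diff_distrib sum_subtractf
        using ij A(1) by (simp add: sum_scale_indicator[where x = ?v])
      then have "(\<Sum>k\<in>?E. ?a k *s ?v k) = 0" using ij(3) by simp
      from zero[OF this ij(1)] ij(4) show False by simp
    qed
    have "int_lattice.independent (?v ` ?E)"
    proof
      assume "int_lattice.dependent (?v ` ?E)"
      then obtain u b where u: "(\<Sum>b\<in>?v ` ?E. u b *s b) = 0" "b \<in> ?v ` ?E" "u b \<noteq> 0"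
        using int_lattice.dependent_finite[of "?v ` ?E"] A(1) by auto
      then have "(\<Sum>i\<in>?E. u (?v i) *s ?v i) = 0" by (simp add: sum.reindex[OF inj])
      then show False using zero[of "\<lambda>i. u (?v i)"] u(2,3) by blast
    qed
    moreover have "?v ` ?E \<subseteq> ?U" using p A(1) by (auto intro: diff_in_zero_sum_span)
    ultimately have "card (?v ` ?E) \<in> ?ranks" using A(1) by blast
    moreover have "card (?v ` ?E) = card A - 1" using card_image[OF inj] card_E by simp
    ultimately have "card A - 1 \<in> ?ranks" by simp
    then show "lattice_rank ?U = card A - 1"
      unfolding lattice_rank_def using fin bound card_E by (intro Max_eqI) auto
  qed
qed


section \<open>Saturated subgroups and direct summands\<close>

text \<open>A torsion-free quotient embeds into a lattice. The map is built one generator at a time: given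
\<open>\<phi>\<close> for \<open>D\<close> and a new generator \<open>d\<close> with \<open>\<phi> d\<close> nonzero in coordinate \<open>i\<close>, eliminate that coordinate,
\<open>\<psi> z = (\<phi> d)\<^sub>i \<phi> z - (\<phi> z)\<^sub>i \<phi> d\<close>. Then \<open>\<psi> z = 0\<close> says that \<open>(\<phi> d)\<^sub>i z - (\<phi> z)\<^sub>i d\<close> lies in the
kernel of \<open>\<phi>\<close>.\<close>

lemma linear_map_with_saturated_kernel:
  fixes D :: "(int ^ 'm) set"
  assumes "finite D"
  shows "\<exists>\<phi> :: int ^ 'm \<Rightarrow> int ^ 'm. (\<forall>a b. \<phi> (a + b) = \<phi> a + \<phi> b) \<and> (\<forall>c a. \<phi> (c *s a) = c *s \<phi> a)
           \<and> (\<forall>z. \<phi> z = 0 \<longleftrightarrow> (\<exists>N. N \<noteq> 0 \<and> N *s z \<in> generate lattice_group D))"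
  using assms
proof induct
  case empty
  have "generate lattice_group {} = {0 :: int ^ 'm}"
    using group.generate_empty[OF group_lattice_group] by simp
  moreover have "(z :: int ^ 'm) = 0 \<longleftrightarrow> (\<exists>N. N \<noteq> 0 \<and> N *s z = 0)" for z
  proof
    assume "\<exists>N. N \<noteq> 0 \<and> N *s z = 0"
    then show "z = 0" by (auto simp: vec_eq_iff)
  qed (auto intro: exI[of _ 1])
  ultimately show ?case by (intro exI[of _ "\<lambda>z. z"]) simp
next
  case (insert d D)
  then obtain \<phi> :: "int ^ 'm \<Rightarrow> int ^ 'm" where add: "\<And>a b. \<phi> (a + b) = \<phi> a + \<phi> b"
    and scale: "\<And>c a. \<phi> (c *s a) = c *s \<phi> a"
    and ker: "\<And>z. \<phi> z = 0 \<longleftrightarrow> (\<exists>N. N \<noteq> 0 \<and> N *s z \<in> generate lattice_group D)" by blast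
  let ?G = "generate lattice_group D" and ?H = "generate lattice_group (insert d D)"
  have G: "subgroup ?G lattice_group" and H: "subgroup ?H lattice_group"
    by (simp_all add: subgroup_generate_lattice)
  have dH: "d \<in> ?H" by (rule generate.incl) simp
  have DH: "?G \<subseteq> ?H" by (intro generate_lattice_minimal[OF H] subsetI generate.incl) simp
  have GK: "\<phi> z = 0" if "z \<in> ?G" for z
    unfolding ker using that by (intro exI[of _ 1]) simp
  have diff: "\<phi> (a - b) = \<phi> a - \<phi> b" for a b using add[of "a - b" b] by (simp add: eq_diff_eq)
  show ?case
  proof (cases "\<phi> d = 0")
    case True
    have H0: "\<phi> z = 0" if "z \<in> ?H" for z
    proof -
      have "subgroup {z. \<phi> z = 0} lattice_group"
        unfolding subgroup_lattice_iff using diff[of 0] scale[of 0 0] by (auto simp: add)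
      moreover have "insert d D \<subseteq> {z. \<phi> z = 0}" using True GK[OF generate.incl] by auto
      ultimately show ?thesis using that generate_lattice_minimal by blast
    qed
    have "\<phi> z = 0 \<longleftrightarrow> (\<exists>N. N \<noteq> 0 \<and> N *s z \<in> ?H)" for z
    proof
      assume "\<phi> z = 0"
      then show "\<exists>N. N \<noteq> 0 \<and> N *s z \<in> ?H" using ker DH by blast
    next
      assume "\<exists>N. N \<noteq> 0 \<and> N *s z \<in> ?H"
      then obtain N where "N \<noteq> 0" "N *s \<phi> z = 0" using H0 scale by metis
      then show "\<phi> z = 0" by (auto simp: vec_eq_iff)
    qed
    then show ?thesis using add scale by blast
  next
    case False
    then obtain i where i: "\<phi> d $ i \<noteq> 0" by (auto simp: vec_eq_iff)
    define \<psi> where "\<psi> z = (\<phi> d $ i) *s \<phi> z - (\<phi> z $ i) *s \<phi> d" for z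
    have add': "\<psi> (a + b) = \<psi> a + \<psi> b" for a b
      by (simp add: \<psi>_def add int_lattice.scale_left_distrib int_lattice.scale_right_distrib)
    have scale': "\<psi> (c *s a) = c *s \<psi> a" for c a
      by (simp add: \<psi>_def scale int_lattice.scale_right_diff_distrib mult.commute)
    have diff': "\<psi> (a - b) = \<psi> a - \<psi> b" for a b using add'[of "a - b" b] by (simp add: eq_diff_eq)
    have H0: "\<psi> z = 0" if "z \<in> ?H" for z
    proof -
      have "\<psi> 0 = 0" using add'[of 0 0] by simp
      then have "subgroup {z. \<psi> z = 0} lattice_group"
        unfolding subgroup_lattice_iff using diff'[of 0] by (auto simp: add')
      moreover have "insert d D \<subseteq> {z. \<psi> z = 0}" by (auto simp: \<psi>_def GK[OF generate.incl])
      ultimately show ?thesis using that generate_lattice_minimal by blast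
    qed
    have "\<psi> z = 0 \<longleftrightarrow> (\<exists>N. N \<noteq> 0 \<and> N *s z \<in> ?H)" for z
    proof
      assume "\<psi> z = 0"
      then have "\<phi> ((\<phi> d $ i) *s z - (\<phi> z $ i) *s d) = 0" by (simp add: \<psi>_def diff scale)
      then obtain N where N: "N \<noteq> 0" "N *s ((\<phi> d $ i) *s z - (\<phi> z $ i) *s d) \<in> ?H"
        using ker DH by blast
      have "N *s ((\<phi> d $ i) *s z - (\<phi> z $ i) *s d) + (N * \<phi> z $ i) *s d \<in> ?H"
        by (intro lattice_subgroup_closed(2)[OF H] N(2) lattice_subgroup_scale[OF H dH])
      moreover have "N *s ((\<phi> d $ i) *s z - (\<phi> z $ i) *s d) + (N * \<phi> z $ i) *s d = (N * \<phi> d $ i) *s z"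
        by (simp add: int_lattice.scale_right_diff_distrib)
      ultimately show "\<exists>N. N \<noteq> 0 \<and> N *s z \<in> ?H"
        using N(1) i by (intro exI[of _ "N * \<phi> d $ i"]) simp
    next
      assume "\<exists>N. N \<noteq> 0 \<and> N *s z \<in> ?H"
      then obtain N where "N \<noteq> 0" "N *s \<psi> z = 0" using H0 scale' by metis
      then show "\<psi> z = 0" by (auto simp: vec_eq_iff)
    qed
    then show ?thesis using add' scale' by (intro exI[of _ \<psi>]) blast
  qed
qed

text \<open>Finitely supported integer sequences are ordered lexicographically.\<close>

lemma lattice_embeds_in_ordered_group:
  obtains \<psi> :: "int ^ 'm \<Rightarrow> nat \<Rightarrow>\<^sub>0 int"
  where "\<And>a b. \<psi> (a + b) = \<psi> a + \<psi> b" "inj \<psi>"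
proof -
  obtain e :: "'m \<Rightarrow> nat" where e: "inj e"
    using finite_imp_inj_to_nat_seg[of "UNIV :: 'm set"] by auto
  let ?\<psi> = "\<lambda>z :: int ^ 'm. \<Sum>i\<in>UNIV. Poly_Mapping.single (e i) (z $ i)"
  have "Poly_Mapping.lookup (?\<psi> z) (e i) = z $ i" for z i
    by (simp add: lookup_sum lookup_single when_def inj_eq[OF e])
  then have "inj ?\<psi>" by (intro injI) (metis vec_eq_iff)
  then show thesis by (rule that[rotated]) (simp add: single_add sum.distrib)
qed

lemma direct_summand_saturated:
  assumes "direct_summand U G" "g \<in> G" "N \<noteq> 0" "N *s g \<in> U"
  shows "g \<in> U"
proof -
  obtain C where U: "subgroup U lattice_group" and C: "subgroup C lattice_group"
    and G: "U <#>\<^bsub>lattice_group\<^esub> C = G" and UC: "U \<inter> C = {0}"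
    using assms(1) unfolding direct_summand_def by blast
  obtain u c where uc: "u \<in> U" "c \<in> C" "g = u + c"
    using assms(2) unfolding G[symmetric] set_mult_def by auto
  have "N *s c = N *s g - N *s u" by (simp add: uc int_lattice.scale_right_distrib)
  then have "N *s c \<in> U"
    using lattice_subgroup_closed(4)[OF U assms(4) lattice_subgroup_scale[OF U uc(1)]] by simp
  then have "N *s c = 0" using lattice_subgroup_scale[OF C uc(2)] UC by blast
  then have "c = 0" using assms(3) by (auto simp: vec_eq_iff)
  then show ?thesis using uc by simp
qed

lemma direct_summandI:
  assumes "subgroup U (lattice_group :: (int ^ 'm) monoid)" "subgroup C lattice_group" "subgroup G lattice_group"
    and "U \<subseteq> G" "C \<subseteq> G" "\<And>g. g \<in> G \<Longrightarrow> \<exists>c\<in>C. g - c \<in> U" "\<And>c. c \<in> U \<Longrightarrow> c \<in> C \<Longrightarrow> c = 0"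
  shows "direct_summand U G"
proof -
  have "U <#>\<^bsub>lattice_group\<^esub> C = G"
  proof
    show "U <#>\<^bsub>lattice_group\<^esub> C \<subseteq> G"
      using assms(4,5) lattice_subgroup_closed(2)[OF assms(3)] by (auto simp: set_mult_def)
    show "G \<subseteq> U <#>\<^bsub>lattice_group\<^esub> C"
    proof
      fix g assume "g \<in> G"
      then obtain c where c: "c \<in> C" "g - c \<in> U" using assms(6) by blast
      then show "g \<in> U <#>\<^bsub>lattice_group\<^esub> C"
        unfolding set_mult_def by (intro UN_I[of "g - c"] UN_I[of c]) simp_all
    qed
  qed
  moreover have "U \<inter> C = {0}"
    using assms(7) lattice_subgroup_closed(1)[OF assms(1)] lattice_subgroup_closed(1)[OF assms(2)] by auto
  ultimately show ?thesis unfolding direct_summand_def using assms(1,2) by blast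
qed

text \<open>The image of \<open>\<rho>\<close> on \<open>H\<close> is a subgroup of \<open>\<int>\<close>, hence cyclic and free: a preimage of its least
positive element generates a complement of the kernel.\<close>

lemma direct_summand_kernel:
  fixes \<rho> :: "int ^ 'm \<Rightarrow> int"
  assumes H: "subgroup H lattice_group" and add: "\<And>a b. \<rho> (a + b) = \<rho> a + \<rho> b"
    and scale: "\<And>c a. \<rho> (c *s a) = c * \<rho> a"
  shows "direct_summand (H \<inter> {z. \<rho> z = 0}) H"
proof -
  have diff: "\<rho> (a - b) = \<rho> a - \<rho> b" for a b using add[of "a - b" b] by simp
  have zero: "\<rho> 0 = 0" using add[of 0 0] by simp
  have U: "subgroup (H \<inter> {z. \<rho> z = 0}) lattice_group"
    unfolding subgroup_lattice_iff using lattice_subgroup_closed[OF H] add zero diff[of 0] by auto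
  show ?thesis
  proof (cases "\<exists>h\<in>H. \<rho> h > 0")
    case False
    have "\<rho> h = 0" if "h \<in> H" for h
      using False that lattice_subgroup_closed(3)[OF H that] diff[of 0 h] zero
      by (metis diff_0 linorder_neqE neg_0_less_iff_less)
    then show ?thesis
      by (intro direct_summandI[of _ "{0}"] U H) (auto simp: subgroup_lattice_iff lattice_subgroup_closed[OF H])
  next
    case True
    then obtain h0 where "h0 \<in> H" "\<rho> h0 > 0" by blast
    then obtain g where g: "g \<in> H" "\<rho> g > 0"
      and min: "\<And>h. h \<in> H \<Longrightarrow> \<rho> h > 0 \<Longrightarrow> nat (\<rho> g) \<le> nat (\<rho> h)"
      using ex_has_least_nat[of "\<lambda>h. h \<in> H \<and> \<rho> h > 0" h0 "\<lambda>h. nat (\<rho> h)"] by blast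
    let ?C = "range (\<lambda>c. c *s g)"
    show ?thesis
    proof (rule direct_summandI[of _ ?C])
      show "subgroup ?C lattice_group"
        unfolding subgroup_lattice_iff
      proof (intro conjI ballI)
        show "0 \<in> ?C" by (rule range_eqI[of _ _ 0]) simp
      next
        fix a b assume "a \<in> ?C" "b \<in> ?C"
        then obtain c d where "a = c *s g" "b = d *s g" by blast
        then show "a + b \<in> ?C"
          by (intro range_eqI[of _ _ "c + d"]) (simp add: int_lattice.scale_left_distrib)
      next
        fix a assume "a \<in> ?C"
        then obtain c where "a = c *s g" by blast
        then show "- a \<in> ?C" by (intro range_eqI[of _ _ "- c"]) simp
      qed
      show "?C \<subseteq> H" using lattice_subgroup_scale[OF H g(1)] by blast
    next
      fix h assume h: "h \<in> H"
      let ?r = "h - (\<rho> h div \<rho> g) *s g"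
      have "?r \<in> H" by (intro lattice_subgroup_closed(4)[OF H] h lattice_subgroup_scale[OF H g(1)])
      moreover have r: "\<rho> ?r = \<rho> h mod \<rho> g" by (simp add: diff scale minus_div_mult_eq_mod)
      ultimately have "\<rho> ?r = 0"
        using min[of ?r] g(2) pos_mod_bound[OF g(2), of "\<rho> h"] pos_mod_sign[OF g(2), of "\<rho> h"]
        by (metis linorder_not_less nat_less_eq_zless order_le_less)
      then show "\<exists>c\<in>?C. h - c \<in> H \<inter> {z. \<rho> z = 0}" using \<open>?r \<in> H\<close> by blast
    next
      fix c assume "c \<in> H \<inter> {z. \<rho> z = 0}" "c \<in> ?C"
      then show "c = 0" using g(2) by (auto simp: scale)
    qed (use U H in auto)
  qed
qed

lemma direct_summand_trans:
  assumes AB: "direct_summand A B" and BG: "direct_summand B G" and G: "subgroup G lattice_group"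
  shows "direct_summand A G"
proof -
  obtain C where A: "subgroup A lattice_group" and C: "subgroup C lattice_group"
    and B: "A <#>\<^bsub>lattice_group\<^esub> C = B" and AC: "A \<inter> C = {0}"
    using AB unfolding direct_summand_def by blast
  obtain D where B': "subgroup B lattice_group" and D: "subgroup D lattice_group"
    and GD: "B <#>\<^bsub>lattice_group\<^esub> D = G" and BD: "B \<inter> D = {0}"
    using BG unfolding direct_summand_def by blast
  have AB': "a \<in> B" if "a \<in> A" for a
    using that lattice_subgroup_closed(1)[OF C] unfolding B[symmetric] set_mult_def by force
  have CB: "c \<in> B" if "c \<in> C" for c
    using that lattice_subgroup_closed(1)[OF A] unfolding B[symmetric] set_mult_def by force
  have BG': "b \<in> G" if "b \<in> B" for b
    using that lattice_subgroup_closed(1)[OF D] unfolding GD[symmetric] set_mult_def by force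
  have DG: "d \<in> G" if "d \<in> D" for d
    using that lattice_subgroup_closed(1)[OF B'] unfolding GD[symmetric] set_mult_def by force
  let ?E = "{c + d |c d. c \<in> C \<and> d \<in> D}"
  have E: "subgroup ?E lattice_group"
    unfolding subgroup_lattice_iff
  proof (intro conjI ballI)
    show "0 \<in> ?E"
      using lattice_subgroup_closed(1)[OF C] lattice_subgroup_closed(1)[OF D] by force
  next
    fix a b assume "a \<in> ?E" "b \<in> ?E"
    then obtain c d c' d' where *: "a = c + d" "b = c' + d'" "c \<in> C" "d \<in> D" "c' \<in> C" "d' \<in> D" by blast
    have "a + b = (c + c') + (d + d')" by (simp add: *)
    then show "a + b \<in> ?E"
      using lattice_subgroup_closed(2)[OF C *(3,5)] lattice_subgroup_closed(2)[OF D *(4,6)] by blast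
  next
    fix a assume "a \<in> ?E"
    then obtain c d where *: "a = c + d" "c \<in> C" "d \<in> D" by blast
    have "- a = - c + - d" by (simp add: *)
    then show "- a \<in> ?E"
      using lattice_subgroup_closed(3)[OF C *(2)] lattice_subgroup_closed(3)[OF D *(3)] by blast
  qed
  show ?thesis
  proof (rule direct_summandI[OF A E G])
    show "A \<subseteq> G" using AB' BG' by blast
    show "?E \<subseteq> G" using CB BG' DG lattice_subgroup_closed(2)[OF G] by blast
  next
    fix g assume "g \<in> G"
    then obtain b d where bd: "b \<in> B" "d \<in> D" "g = b + d" unfolding GD[symmetric] set_mult_def by auto
    then obtain a c where ac: "a \<in> A" "c \<in> C" "b = a + c" unfolding B[symmetric] set_mult_def by auto
    have "g - (c + d) = a" by (simp add: bd ac)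
    then show "\<exists>e\<in>?E. g - e \<in> A" using ac bd by blast
  next
    fix a assume a: "a \<in> A" "a \<in> ?E"
    then obtain c d where *: "a = c + d" "c \<in> C" "d \<in> D" by blast
    have "a - c \<in> B" using lattice_subgroup_closed(4)[OF B' AB'[OF a(1)] CB[OF *(2)]] .
    then have "d = 0" using * BD by auto
    then show "a = 0" using a(1) * AC by auto
  qed
qed

text \<open>A saturated \<open>U\<close> is cut out in \<open>G\<close> by finitely many linear functionals, the coordinates of the
map above, and each of them splits off a summand.\<close>

lemma saturated_direct_summand:
  fixes D :: "(int ^ 'm) set"
  assumes "finite D" and U: "U = generate lattice_group D" and G: "subgroup G lattice_group" and "U \<subseteq> G"
    and sat: "\<And>g N. g \<in> G \<Longrightarrow> N \<noteq> 0 \<Longrightarrow> N *s g \<in> U \<Longrightarrow> g \<in> U"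
  shows "direct_summand U G"
proof -
  obtain \<phi> :: "int ^ 'm \<Rightarrow> int ^ 'm" where add: "\<And>a b. \<phi> (a + b) = \<phi> a + \<phi> b"
    and scale: "\<And>c a. \<phi> (c *s a) = c *s \<phi> a"
    and ker: "\<And>z. \<phi> z = 0 \<longleftrightarrow> (\<exists>N. N \<noteq> 0 \<and> N *s z \<in> U)"
    using linear_map_with_saturated_kernel[OF assms(1)] unfolding U by blast
  have summand: "direct_summand (G \<inter> {z. \<forall>i\<in>T. \<phi> z $ i = 0}) G" if "finite T" for T
    using that
  proof induct
    case empty
    show ?case
      by (rule direct_summandI[of _ "{0}"]) (auto simp: subgroup_lattice_iff lattice_subgroup_closed[OF G])
  next
    case (insert i T)
    let ?H = "G \<inter> {z. \<forall>i\<in>T. \<phi> z $ i = 0}"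
    have "subgroup ?H lattice_group" using insert(3) unfolding direct_summand_def by blast
    then have "direct_summand (?H \<inter> {z. \<phi> z $ i = 0}) ?H"
      by (rule direct_summand_kernel) (simp_all add: add scale)
    then have "direct_summand (?H \<inter> {z. \<phi> z $ i = 0}) G"
      using insert(3) G by (rule direct_summand_trans)
    moreover have "?H \<inter> {z. \<phi> z $ i = 0} = G \<inter> {z. \<forall>j\<in>insert i T. \<phi> z $ j = 0}" by auto
    ultimately show ?case by simp
  qed
  have "U = G \<inter> {z. \<phi> z = 0}"
  proof
    have "\<phi> u = 0" if "u \<in> U" for u unfolding ker using that by (intro exI[of _ 1]) simp
    then show "U \<subseteq> G \<inter> {z. \<phi> z = 0}" using assms(4) by blast
    show "G \<inter> {z. \<phi> z = 0} \<subseteq> U" using ker sat by blast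
  qed
  also have "\<dots> = G \<inter> {z. \<forall>i\<in>UNIV. \<phi> z $ i = 0}" by (auto simp: vec_eq_iff)
  finally show ?thesis using summand[of UNIV] by simp
qed

section \<open>Sums over index multisets\<close>

lemma sum_mset_eq_sum_count:
  fixes x :: "'i \<Rightarrow> int ^ 'm"
  assumes "finite A" "set_mset P \<subseteq> A"
  shows "(\<Sum>i\<in>#P. x i) = (\<Sum>i\<in>A. int (count P i) *s x i)"
  using assms(2)
proof (induct P)
  case empty
  show ?case by simp
next
  case (add j P)
  have "int (count (add_mset j P) i) = int (count P i) + (if i = j then 1 else 0)" for i by simp
  then have "(\<Sum>i\<in>A. int (count (add_mset j P) i) *s x i)
      = (\<Sum>i\<in>A. int (count P i) *s x i) + (\<Sum>i\<in>A. (if i = j then 1 else 0) *s x i)"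
    by (simp only: int_lattice.scale_left_distrib sum.distrib)
  also have "(\<Sum>i\<in>A. (if i = j then 1 else 0) *s x i) = x j"
    using add(2) assms(1) by (simp add: sum_scale_indicator)
  finally show ?case using add by (simp add: add.commute)
qed

lemma size_eq_sum_count:
  assumes "finite A" "set_mset P \<subseteq> A"
  shows "size P = (\<Sum>i\<in>A. count P i)"
  unfolding size_multiset_overloaded_eq using assms by (intro sum.mono_neutral_left) (auto simp: not_in_iff)

text \<open>Multisets of indices represent the monomials in the \<open>X^x\<^sub>i\<close>, with the size as degree. The two
multisets collect the positive and the negative coefficients of a zero-sum combination, whence
they are disjoint and of equal size.\<close>

lemma zero_sum_span_multisets:
  assumes "finite A" "u \<in> zero_sum_span A x"
  obtains P Q where "set_mset P \<subseteq> A" "set_mset Q \<subseteq> A" "set_mset P \<inter> set_mset Q = {}" "size P = size Q"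
    "u = (\<Sum>i\<in>#P. x i) - (\<Sum>i\<in>#Q. x i)"
proof -
  obtain c where c: "u = (\<Sum>i\<in>A. c i *s x i)" "(\<Sum>i\<in>A. c i) = 0"
    using assms(2) unfolding zero_sum_span_def by blast
  define F where "F = (\<lambda>e :: _ \<Rightarrow> nat. \<Sum>i\<in>A. replicate_mset (e i) i)"
  have count: "count (F e) i = (if i \<in> A then e i else 0)" for e i
    using assms(1) by (simp add: F_def count_sum)
  have FA: "set_mset (F e) \<subseteq> A" for e
    using count[of e] by (metis count_eq_zero_iff subsetI)
  let ?P = "F (\<lambda>i. nat (c i))" and ?Q = "F (\<lambda>i. nat (- c i))"
  have "set_mset ?P \<inter> set_mset ?Q = {}"
    unfolding set_mset_def by (auto simp: count)
  moreover have eq: "int (count ?P i) - int (count ?Q i) = c i" if "i \<in> A" for i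
    using that by (simp add: count)
  have "int (size ?P) - int (size ?Q) = (\<Sum>i\<in>A. int (count ?P i) - int (count ?Q i))"
    by (simp add: size_eq_sum_count[OF assms(1) FA] sum_subtractf)
  then have "size ?P = size ?Q" using c(2) eq by simp
  moreover have "(\<Sum>i\<in>#?P. x i) - (\<Sum>i\<in>#?Q. x i) = (\<Sum>i\<in>A. (int (count ?P i) - int (count ?Q i)) *s x i)"
    by (simp add: sum_mset_eq_sum_count[OF assms(1) FA] int_lattice.scale_left_diff_distrib sum_subtractf)
  then have "u = (\<Sum>i\<in>#?P. x i) - (\<Sum>i\<in>#?Q. x i)" using c(1) eq by simp
  ultimately show thesis using FA that by blast
qed

lemma int_affine_independent_multisets:
  assumes "int_affine_independent A x" "finite A" "set_mset P \<subseteq> A" "set_mset Q \<subseteq> A"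
    and "size P = size Q" "(\<Sum>i\<in>#P. x i) = (\<Sum>i\<in>#Q. x i)"
  shows "P = Q"
proof (rule multiset_eqI)
  fix i
  let ?c = "\<lambda>i. int (count P i) - int (count Q i)"
  have "(\<Sum>i\<in>A. ?c i) = int (size P) - int (size Q)"
    by (simp add: size_eq_sum_count[OF assms(2)] assms(3,4) sum_subtractf)
  moreover have "(\<Sum>i\<in>A. ?c i *s x i) = (\<Sum>i\<in>#P. x i) - (\<Sum>i\<in>#Q. x i)"
    by (simp add: sum_mset_eq_sum_count[OF assms(2)] assms(3,4) int_lattice.scale_left_diff_distrib sum_subtractf)
  ultimately have "(\<Sum>i\<in>A. ?c i) = 0" "(\<Sum>i\<in>A. ?c i *s x i) = 0" using assms(5,6) by simp_all
  with assms(1)[unfolded int_affine_independent_def, THEN spec, of ?c] have "\<forall>i\<in>A. ?c i = 0"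
    by (rule mp[OF mp])
  moreover have "count P i = 0" "count Q i = 0" if "i \<notin> A"
    using that assms(3,4) by (auto simp: count_eq_zero_iff)
  ultimately show "count P i = count Q i" by (cases "i \<in> A") auto
qed


locale noninvertible_family = lattice_monoid_algebra M R
  for M :: "(int ^ 'm) set" and R :: "((int ^ 'm) \<Rightarrow>\<^sub>0 'k::field) ring" +
  fixes x :: "nat \<Rightarrow> int ^ 'm" and n :: nat
  assumes affine_M: "affine_monoid M"
    and x_in_M: "i \<in> {1..n} \<Longrightarrow> x i \<in> M"
    and noninvertible: "i \<in> {1..n} \<Longrightarrow> - x i \<notin> M"
    and n_pos: "1 \<le> n"
begin

section \<open>Regular sequences of monomials\<close>

text \<open>The combinatorial form of the condition that \<open>X^x\<^sub>i\<close> is a nonzerodivisor modulo the monomial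
ideal generated by the \<open>X^x\<^sub>j\<close> with \<open>j \<in> S\<close>.\<close>

definition regular_modulo :: "nat set \<Rightarrow> nat \<Rightarrow> bool" where
  "regular_modulo S i \<longleftrightarrow> (\<forall>a\<in>M. (\<exists>j\<in>S. a + x i - x j \<in> M) \<longrightarrow> (\<exists>j\<in>S. a - x j \<in> M))"

definition pairwise_regular :: bool where
  "pairwise_regular \<longleftrightarrow> (\<forall>i\<in>{1..n}. \<forall>j\<in>{1..n}. i \<noteq> j \<longrightarrow> regular_modulo {j} i)"

text \<open>A graded Nakayama argument. A witness \<open>a\<close> against regularity modulo \<open>S\<close> must be divisible by
\<open>x s\<close>, and by regularity of \<open>x s\<close> modulo \<open>S\<close> the quotient \<open>a - x s\<close> is again a witness. So
\<open>a - k x s \<in> M\<close> for all \<open>k\<close>, and two of these elements differ by a negative multiple of \<open>x s\<close> in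
\<open>M\<close>, which contradicts noninvertibility.\<close>

lemma regular_modulo_remove:
  assumes "S \<subseteq> {1..n}" "s \<in> {1..n}" "i \<in> {1..n}"
    and "regular_modulo (insert s S) i" "regular_modulo S s"
  shows "regular_modulo S i"
  unfolding regular_modulo_def
proof (intro ballI impI, rule ccontr)
  fix a assume a: "a \<in> M" "\<exists>j\<in>S. a + x i - x j \<in> M" "\<not> (\<exists>j\<in>S. a - x j \<in> M)"
  have step: "a - int (Suc k) *s x s \<in> M \<and> (\<exists>j\<in>S. (a - int (Suc k) *s x s) + x i - x j \<in> M)
        \<and> \<not> (\<exists>j\<in>S. (a - int (Suc k) *s x s) - x j \<in> M)"
    if b: "a - int k *s x s \<in> M" "\<exists>j\<in>S. (a - int k *s x s) + x i - x j \<in> M"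
      "\<not> (\<exists>j\<in>S. (a - int k *s x s) - x j \<in> M)" for k
  proof -
    let ?b = "a - int k *s x s" and ?c = "a - int (Suc k) *s x s"
    have bc: "?b = ?c + x s" by (simp add: int_lattice.scale_left_distrib)
    have "\<exists>j\<in>insert s S. ?b - x j \<in> M"
      using assms(4) b(1,2) unfolding regular_modulo_def by blast
    then have cM: "?c \<in> M" using b(3) bc by auto
    obtain j where j: "j \<in> S" "?b + x i - x j \<in> M" using b(2) by blast
    have "?b + x i - x j = (?c + x i) + x s - x j" by (simp add: bc)
    moreover have "?c + x i \<in> M" using cM x_in_M[OF assms(3)] by (rule add_in_M)
    ultimately have "\<exists>j\<in>S. ?c + x i - x j \<in> M"
      using assms(5) j unfolding regular_modulo_def by metis
    moreover have "\<not> (\<exists>j\<in>S. ?c - x j \<in> M)"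
    proof
      assume "\<exists>j\<in>S. ?c - x j \<in> M"
      then obtain j where j: "j \<in> S" "?c - x j \<in> M" by blast
      have "(?c - x j) + x s \<in> M" using j(2) x_in_M[OF assms(2)] by (rule add_in_M)
      moreover have "(?c - x j) + x s = ?b - x j" by (simp add: bc)
      ultimately show False using b(3) j(1) by metis
    qed
    ultimately show ?thesis using cM by blast
  qed
  have "a - int k *s x s \<in> M \<and> (\<exists>j\<in>S. (a - int k *s x s) + x i - x j \<in> M)
        \<and> \<not> (\<exists>j\<in>S. (a - int k *s x s) - x j \<in> M)" for k
  proof (induct k)
    case 0
    then show ?case using a by simp
  next
    case (Suc k)
    then show ?case using step[of k] by blast
  qed
  then have "a - int k *s x s \<in> M" for k by blast
  then obtain k l where kl: "k < l" "(a - int l *s x s) - (a - int k *s x s) \<in> M"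
    by (rule affine_monoid_wqo[OF affine_M, of "\<lambda>k. a - int k *s x s"])
  have "(a - int l *s x s) - (a - int k *s x s) + int (l - k - 1) *s x s \<in> M"
    using kl(2) scale_in_M[OF x_in_M[OF assms(2)]] by (rule add_in_M)
  moreover have "(a - int l *s x s) - (a - int k *s x s) + int (l - k - 1) *s x s
      = (int k - int l + int (l - k - 1)) *s x s"
    by (simp add: int_lattice.scale_left_distrib int_lattice.scale_left_diff_distrib)
  moreover have "int k - int l + int (l - k - 1) = - 1" using kl(1) by simp
  ultimately show False using noninvertible[OF assms(2)] by simp
qed

text \<open>If \<open>a + x s = z + x i\<close>, then regularity of \<open>x i\<close> modulo \<open>S\<close> and \<open>x s\<close> lets \<open>x s\<close> divide \<open>z\<close> up to
\<open>S\<close>, and dividing by \<open>x s\<close> shows that \<open>x i\<close> divides \<open>a\<close>.\<close>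

lemma regular_modulo_swap:
  assumes "regular_modulo S s" "regular_modulo (insert s S) i" "i \<in> {1..n}"
  shows "regular_modulo (insert i S) s"
  unfolding regular_modulo_def
proof (intro ballI impI)
  fix a assume a: "a \<in> M" "\<exists>j\<in>insert i S. a + x s - x j \<in> M"
  show "\<exists>j\<in>insert i S. a - x j \<in> M"
  proof (cases "\<exists>j\<in>S. a + x s - x j \<in> M")
    case True
    then show ?thesis using assms(1) a(1) unfolding regular_modulo_def by blast
  next
    case False
    define z where "z = a + x s - x i"
    have z: "z \<in> M" using a(2) False by (auto simp: z_def)
    have "z + x i - x s \<in> M" using a(1) by (simp add: z_def)
    then have "\<exists>j\<in>insert s S. z - x j \<in> M"
      using assms(2) z unfolding regular_modulo_def by blast
    then consider "z - x s \<in> M" | j where "j \<in> S" "z - x j \<in> M" by blast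
    then show ?thesis
    proof cases
      case 1
      then show ?thesis by (simp add: z_def)
    next
      case 2
      have "(z - x j) + x i \<in> M" using 2(2) x_in_M[OF assms(3)] by (rule add_in_M)
      moreover have "(z - x j) + x i = a + x s - x j" by (simp add: z_def)
      ultimately show ?thesis using 2(1) False by metis
    qed
  qed
qed

text \<open>Induction on the length. The new element \<open>Suc k\<close> is regular modulo all subsets of \<open>{1..k}\<close> by
removing elements one by one; exchanging it with another element handles the sets that contain
it.\<close>

lemma regular_modulo_permute:
  assumes "\<And>i. i \<in> {1..k} \<Longrightarrow> regular_modulo {1..<i} i" "k \<le> n"
  shows "S \<subseteq> {1..k} \<Longrightarrow> i \<in> {1..k} - S \<Longrightarrow> regular_modulo S i"
  using assms
proof (induct k arbitrary: S i)
  case 0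
  then show ?case by simp
next
  case (Suc k)
  have IH: "regular_modulo S i" if "S \<subseteq> {1..k}" "i \<in> {1..k} - S" for S i
    using Suc(1)[OF that] Suc(4,5) by simp
  have last: "regular_modulo ({1..k} - T) (Suc k)" if "finite T" "T \<subseteq> {1..k}" for T
    using that
  proof (induct T rule: finite_induct)
    case empty
    have "{1..k} = {1..<Suc k}" by auto
    then show ?case using Suc(4)[of "Suc k"] by simp
  next
    case (insert s T)
    have "insert s ({1..k} - insert s T) = {1..k} - T" using insert(2,4) by blast
    then have "regular_modulo (insert s ({1..k} - insert s T)) (Suc k)" using insert by simp
    moreover have "regular_modulo ({1..k} - insert s T) s" using insert(4) by (intro IH) auto
    ultimately show ?case
      by (rule regular_modulo_remove[of _ s, rotated 3]) (use insert(4) Suc(5) in auto)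
  qed
  have last': "regular_modulo S (Suc k)" if "S \<subseteq> {1..k}" for S
  proof -
    have "{1..k} - ({1..k} - S) = S" using that by blast
    then show ?thesis using last[of "{1..k} - S"] by simp
  qed
  show ?case
  proof (cases "i = Suc k")
    case True
    then have "S \<subseteq> {1..k}" using Suc(2,3) by (force simp: atLeastAtMostSuc_conv)
    then show ?thesis using last' True by simp
  next
    case i: False
    then have ik: "i \<in> {1..k}" using Suc(3) by auto
    show ?thesis
    proof (cases "Suc k \<in> S")
      case False
      then have "S \<subseteq> {1..k}" using Suc(2) by (force simp: atLeastAtMostSuc_conv)
      then show ?thesis using IH ik Suc(3) by blast
    next
      case True
      let ?T = "S - {Suc k}"
      have T: "?T \<subseteq> {1..k}" using Suc(2) by (force simp: atLeastAtMostSuc_conv)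
      have "regular_modulo ?T i" using T ik Suc(3) by (intro IH) auto
      moreover have "regular_modulo (insert i ?T) (Suc k)" using T ik by (intro last') auto
      ultimately have "regular_modulo (insert (Suc k) ?T) i"
        by (rule regular_modulo_swap) (use Suc(5) in auto)
      then show ?thesis using True by (simp add: insert_absorb)
    qed
  qed
qed

lemma nonzerodivisor_monomial_iff:
  assumes "S \<subseteq> {1..n}" "i \<in> {1..n}"
  defines "J \<equiv> Idl\<^bsub>R\<^esub> ((\<lambda>i. monomial (x i)) ` S)"
  shows "(\<forall>h\<in>carrier R. monomial (x i) * h \<in> J \<longrightarrow> h \<in> J) \<longleftrightarrow> regular_modulo S i"
proof -
  have J: "J = {f. \<forall>a\<in>Poly_Mapping.keys f. \<exists>j\<in>S. a - x j \<in> M}"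
    unfolding J_def by (rule Idl_monomials) (use assms(1) x_in_M in blast)
  show ?thesis
  proof
    assume *: "\<forall>h\<in>carrier R. monomial (x i) * h \<in> J \<longrightarrow> h \<in> J"
    show "regular_modulo S i"
      unfolding regular_modulo_def
    proof (intro ballI impI)
      fix a assume a: "a \<in> M" "\<exists>j\<in>S. a + x i - x j \<in> M"
      then have "monomial (x i) * monomial a \<in> J" by (simp add: J monomial_mult add.commute)
      then have "monomial a \<in> J" using * a(1) by simp
      then show "\<exists>j\<in>S. a - x j \<in> M" by (simp add: J)
    qed
  next
    assume "regular_modulo S i"
    then show "\<forall>h\<in>carrier R. monomial (x i) * h \<in> J \<longrightarrow> h \<in> J"
      unfolding regular_modulo_def by (auto simp: J keys_monomial_mult)
  qed
qed

text \<open>Pairwise regularity suffices for a regular sequence because a union of principal monoid ideals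
is tested one ideal at a time.\<close>

lemma regular_monomials_iff:
  "regular_sequence R (map (\<lambda>i. monomial (x i)) [1..<n + 1]) \<longleftrightarrow> pairwise_regular"
proof -
  let ?J = "\<lambda>S. Idl\<^bsub>R\<^esub> ((\<lambda>i. monomial (x i)) ` S)"
  have "?J {1..<n + 1} = {f. \<forall>a\<in>Poly_Mapping.keys f. \<exists>j\<in>{1..<n + 1}. a - x j \<in> M}"
    by (rule Idl_monomials) (use x_in_M in auto)
  then have "1 \<notin> ?J {1..<n + 1}" using noninvertible by simp
  moreover have "(1 :: (int ^ 'm) \<Rightarrow>\<^sub>0 'k) \<in> carrier R" using zero_in_M by simp
  ultimately have proper: "?J {1..<n + 1} \<noteq> carrier R" by blast
  have "regular_sequence R (map (\<lambda>i. monomial (x i)) [1..<n + 1])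
      \<longleftrightarrow> (\<forall>i\<in>{1..<n + 1}. \<forall>h\<in>carrier R. monomial (x i) * h \<in> ?J {1..<i} \<longrightarrow> h \<in> ?J {1..<i})"
    unfolding regular_sequence_map_iff using proper x_in_M by simp
  also have "\<dots> \<longleftrightarrow> (\<forall>i\<in>{1..n}. regular_modulo {1..<i} i)"
  proof -
    have "(\<forall>h\<in>carrier R. monomial (x i) * h \<in> ?J {1..<i} \<longrightarrow> h \<in> ?J {1..<i})
        \<longleftrightarrow> regular_modulo {1..<i} i" if "i \<in> {1..n}" for i
      using that by (intro nonzerodivisor_monomial_iff) auto
    moreover have "{1..<n + 1} = {1..n}" by auto
    ultimately show ?thesis by (metis (no_types, lifting))
  qed
  also have "\<dots> \<longleftrightarrow> pairwise_regular"
  proof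
    assume "\<forall>i\<in>{1..n}. regular_modulo {1..<i} i"
    then show pairwise_regular
      unfolding pairwise_regular_def using regular_modulo_permute[of n "{j}" i for i j] by auto
  next
    assume pw: pairwise_regular
    show "\<forall>i\<in>{1..n}. regular_modulo {1..<i} i"
      unfolding regular_modulo_def
    proof (intro ballI impI)
      fix i a assume i: "i \<in> {1..n}" and a: "a \<in> M" "\<exists>j\<in>{1..<i}. a + x i - x j \<in> M"
      then obtain j where j: "j \<in> {1..<i}" "a + x i - x j \<in> M" by blast
      then have "regular_modulo {j} i" using pw i unfolding pairwise_regular_def by auto
      then have "a - x j \<in> M" using a(1) j(2) unfolding regular_modulo_def by blast
      then show "\<exists>j\<in>{1..<i}. a - x j \<in> M" using j(1) by blast
    qed
  qed
  finally show ?thesis .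
qed

lemma pairwise_regularD:
  assumes pairwise_regular "i \<in> {1..n}" "j \<in> {1..n}" "i \<noteq> j" "a \<in> M" "a + x i - x j \<in> M"
  shows "a - x j \<in> M"
  using assms unfolding pairwise_regular_def regular_modulo_def by blast

section \<open>The binomial ideal\<close>

definition binomial_ideal :: "nat \<Rightarrow> ((int ^ 'm) \<Rightarrow>\<^sub>0 'k) set" where
  "binomial_ideal k = Idl\<^bsub>R\<^esub> ((\<lambda>i. monomial (x i) - monomial (x (i + 1))) ` {1..<k})"

text \<open>The group generated by the first \<open>k - 1\<close> consecutive differences.\<close>

abbreviation U :: "nat \<Rightarrow> (int ^ 'm) set" where
  "U k \<equiv> zero_sum_span {1..k} x"

lemma binomial_generators_in_carrier:
  assumes "k \<le> n"
  shows "(\<lambda>i. monomial (x i) - monomial (x (i + 1)) :: (int ^ 'm) \<Rightarrow>\<^sub>0 'k) ` {1..<k} \<subseteq> carrier R"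
proof (rule image_subsetI)
  fix i assume "i \<in> {1..<k}"
  then have "x i \<in> M" "x (i + 1) \<in> M" using assms by (auto intro!: x_in_M)
  then show "(monomial (x i) - monomial (x (i + 1)) :: (int ^ 'm) \<Rightarrow>\<^sub>0 'k) \<in> carrier R"
    using diff_carrier[of "monomial (x i)" "monomial (x (i + 1))"] by simp
qed

lemma ideal_binomial_ideal: "k \<le> n \<Longrightarrow> ideal (binomial_ideal k) R"
  unfolding binomial_ideal_def by (intro ideal_Idl binomial_generators_in_carrier)

lemma binomial_ideal_minimal:
  assumes "ideal I R" "\<And>i. i \<in> {1..<k} \<Longrightarrow> monomial (x i) - monomial (x (i + 1)) \<in> I"
  shows "binomial_ideal k \<subseteq> I"
  unfolding binomial_ideal_def using assms by (intro Idl_minimal) auto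

lemma binomial_ideal_subset_balanced:
  assumes "k \<le> n"
  shows "binomial_ideal k \<subseteq> balanced (U k)"
proof (rule binomial_ideal_minimal[OF ideal_balanced[OF subgroup_zero_sum_span]])
  fix i assume "i \<in> {1..<k}"
  then show "monomial (x i) - monomial (x (i + 1)) \<in> balanced (U k)"
    using assms by (subst binomial_in_balanced_iff[OF subgroup_zero_sum_span])
      (auto intro!: x_in_M diff_in_zero_sum_span simp del: One_nat_def)
qed

lemma generator_difference_in_binomial_ideal:
  assumes "k \<le> n" "i \<in> {1..k}" "j \<in> {1..k}"
  shows "monomial (x i) - monomial (x j) \<in> binomial_ideal k"
proof -
  have I: "ideal (binomial_ideal k) R" using assms(1) by (rule ideal_binomial_ideal)
  have diff: "monomial (x 1) - monomial (x j) \<in> binomial_ideal k" if "1 \<le> j" "j \<le> k" for j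
    using that
  proof (induct j rule: nat_induct_at_least)
    case base
    show ?case using ideal_closed(2)[OF I] by simp
  next
    case (Suc j)
    have "monomial (x j) - monomial (x (j + 1)) \<in> binomial_ideal k"
      using Suc Idl_superset[OF binomial_generators_in_carrier[OF assms(1)]]
      unfolding binomial_ideal_def by auto
    then have "(monomial (x 1) - monomial (x j)) + (monomial (x j) - monomial (x (j + 1))) \<in> binomial_ideal k"
      using Suc by (intro ideal_closed(3)[OF I]) auto
    then show ?case by simp
  qed
  have "(monomial (x 1) - monomial (x j)) - (monomial (x 1) - monomial (x i)) \<in> binomial_ideal k"
    by (rule ideal_closed(5)[OF I diff diff]) (use assms in auto)
  then show ?thesis by simp
qed

lemma sum_mset_in_M: "set_mset P \<subseteq> {1..n} \<Longrightarrow> (\<Sum>i\<in>#P. x i) \<in> M"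
  by (induct P) (auto simp: zero_in_M intro!: add_in_M x_in_M)

text \<open>Modulo the ideal every monomial of degree \<open>s\<close> in the \<open>X^x\<^sub>i\<close> is congruent to the \<open>s\<close>-th power of
the first one.\<close>

lemma equal_size_binomial_in_binomial_ideal:
  assumes "k \<le> n" "set_mset P \<subseteq> {1..k}" "set_mset Q \<subseteq> {1..k}" "size P = size Q"
  shows "monomial (\<Sum>i\<in>#P. x i) - monomial (\<Sum>i\<in>#Q. x i) \<in> binomial_ideal k"
proof -
  have I: "ideal (binomial_ideal k) R" using assms(1) by (rule ideal_binomial_ideal)
  have power: "monomial (\<Sum>i\<in>#P. x i) - monomial (int (size P) *s x 1) \<in> binomial_ideal k"
    if "set_mset P \<subseteq> {1..k}" for P
    using that
  proof (induct P)
    case empty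
    show ?case using ideal_closed(2)[OF I] by simp
  next
    case (add j P)
    let ?s = "\<Sum>i\<in>#P. x i" and ?t = "int (size P) *s x 1"
    have j: "j \<in> {1..k}" "1 \<in> {1..k}" using add(2) by auto
    have xj: "x j \<in> M" "x 1 \<in> M" using j assms(1) by (auto intro!: x_in_M)
    have "monomial (x j) * (monomial ?s - monomial ?t) \<in> binomial_ideal k"
      using add xj by (intro ideal_closed(4)[OF I]) auto
    moreover have "monomial ?t * (monomial (x j) - monomial (x 1)) \<in> binomial_ideal k"
      using scale_in_M[OF xj(2)] j assms(1)
      by (intro ideal_closed(4)[OF I] generator_difference_in_binomial_ideal) auto
    ultimately have "monomial (x j) * (monomial ?s - monomial ?t) + monomial ?t * (monomial (x j) - monomial (x 1))
        \<in> binomial_ideal k" by (rule ideal_closed(3)[OF I])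
    moreover have "int (size (add_mset j P)) *s x 1 = ?t + x 1"
      by (simp add: int_lattice.scale_left_distrib)
    ultimately show ?case by (simp add: right_diff_distrib monomial_mult add.commute)
  qed
  have "(monomial (\<Sum>i\<in>#P. x i) - monomial (int (size P) *s x 1))
      - (monomial (\<Sum>i\<in>#Q. x i) - monomial (int (size P) *s x 1)) \<in> binomial_ideal k"
    using ideal_closed(5)[OF I power[OF assms(2)] power[OF assms(3)]] assms(4) by simp
  then show ?thesis by simp
qed

text \<open>After inverting the monomials, \<open>a - b \<in> U k\<close> becomes equivalent to membership of \<open>X^a - X^b\<close>; the
factor \<open>X^q\<close> clears the negative coefficients of \<open>a - b\<close>.\<close>

lemma shifted_binomial_in_binomial_ideal:
  assumes "k \<le> n" "a \<in> M" "b \<in> M" "a - b \<in> U k"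
  obtains q where "q \<in> M" "monomial q * (monomial a - monomial b) \<in> binomial_ideal k"
proof -
  have I: "ideal (binomial_ideal k) R" using assms(1) by (rule ideal_binomial_ideal)
  obtain P Q where PQ: "set_mset P \<subseteq> {1..k}" "set_mset Q \<subseteq> {1..k}" "size P = size Q"
    "a - b = (\<Sum>i\<in>#P. x i) - (\<Sum>i\<in>#Q. x i)"
    by (rule zero_sum_span_multisets[OF finite_atLeastAtMost assms(4)])
  let ?p = "\<Sum>i\<in>#P. x i" and ?q = "\<Sum>i\<in>#Q. x i"
  have "monomial b * (monomial ?p - monomial ?q) \<in> binomial_ideal k"
    using equal_size_binomial_in_binomial_ideal[OF assms(1) PQ(1-3)] assms(3)
    by (intro ideal_closed(4)[OF I]) auto
  moreover have "?q + a = b + ?p" using PQ(4) by (simp add: algebra_simps)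
  ultimately have "monomial ?q * (monomial a - monomial b) \<in> binomial_ideal k"
    by (simp add: right_diff_distrib monomial_mult add.commute)
  moreover have "?q \<in> M" using PQ(2) assms(1) by (intro sum_mset_in_M) auto
  ultimately show thesis by (rule that[rotated])
qed




section \<open>Monomial regularity makes the binomial ideals prime\<close>

lemma cancel_disjoint_generators:
  assumes pairwise_regular "j \<in> {1..n}" "set_mset Q \<subseteq> {1..n}" "j \<notin># Q" "a \<in> M"
    and "a + (\<Sum>i\<in>#Q. x i) - x j \<in> M"
  shows "a - x j \<in> M"
  using assms(3-6)
proof (induct Q arbitrary: a)
  case empty
  then show ?case by simp
next
  case (add i Q)
  have i: "i \<in> {1..n}" "i \<noteq> j" using add(2,3) by auto
  have "(a + x i) + (\<Sum>i\<in>#Q. x i) - x j \<in> M" using add(5) by (simp add: add_ac)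
  moreover have "a + x i \<in> M" using add(4) x_in_M[OF i(1)] by (rule add_in_M)
  ultimately have "a + x i - x j \<in> M" using add(1)[of "a + x i"] add(2,3) by simp
  then show ?case using pairwise_regularD[OF assms(1) i(1) assms(2) i(2) add(4)] by blast
qed

text \<open>Each \<open>x j\<close> with \<open>j \<in># P\<close> divides \<open>a + \<Sum>Q\<close>, hence divides \<open>a\<close>, since \<open>j\<close> does not occur in \<open>Q\<close>.\<close>

lemma factor_disjoint_generators:
  assumes pairwise_regular "set_mset P \<subseteq> {1..n}" "set_mset Q \<subseteq> {1..n}" "set_mset P \<inter> set_mset Q = {}"
    and "a \<in> M" "b \<in> M" "a + (\<Sum>i\<in>#Q. x i) = b + (\<Sum>i\<in>#P. x i)"
  shows "\<exists>w\<in>M. a = w + (\<Sum>i\<in>#P. x i) \<and> b = w + (\<Sum>i\<in>#Q. x i)"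
  using assms(2,4,5,7)
proof (induct P arbitrary: a)
  case empty
  then show ?case by (intro bexI[of _ a]) auto
next
  case (add j P)
  have "a + (\<Sum>i\<in>#Q. x i) - x j = b + (\<Sum>i\<in>#P. x i)" using add(5) by (simp add: algebra_simps)
  moreover have "b + (\<Sum>i\<in>#P. x i) \<in> M"
    using add(2) assms(6) by (intro add_in_M sum_mset_in_M) auto
  ultimately have "a + (\<Sum>i\<in>#Q. x i) - x j \<in> M" by simp
  then have aj: "a - x j \<in> M"
    by (rule cancel_disjoint_generators[OF assms(1) _ assms(3), rotated 3]) (use add(2-4) in auto)
  have "(a - x j) + (\<Sum>i\<in>#Q. x i) = b + (\<Sum>i\<in>#P. x i)" using add(5) by (simp add: algebra_simps)
  then obtain w where "w \<in> M" "a - x j = w + (\<Sum>i\<in>#P. x i)" "b = w + (\<Sum>i\<in>#Q. x i)"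
    using add(1)[of "a - x j"] add(2,3) aj by auto
  then show ?case by (intro bexI[of _ w]) (auto simp: algebra_simps)
qed

text \<open>With disjoint representing multisets the factor \<open>X^q\<close> above can be cancelled: \<open>X^a - X^b\<close> is a
multiple of the binomial of two monomials of equal degree in the \<open>X^x\<^sub>i\<close>.\<close>

lemma binomial_ideal_eq_balanced:
  assumes pairwise_regular "k \<le> n"
  shows "binomial_ideal k = balanced (U k)"
proof
  show "binomial_ideal k \<subseteq> balanced (U k)" using assms(2) by (rule binomial_ideal_subset_balanced)
  have I: "ideal (binomial_ideal k) R" using assms(2) by (rule ideal_binomial_ideal)
  show "balanced (U k) \<subseteq> binomial_ideal k"
  proof (rule balanced_subset_ideal[OF I subgroup_zero_sum_span])
    fix a b assume ab: "a \<in> M" "b \<in> M" "a - b \<in> U k"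
    obtain P Q where PQ: "set_mset P \<subseteq> {1..k}" "set_mset Q \<subseteq> {1..k}" "set_mset P \<inter> set_mset Q = {}"
      "size P = size Q" "a - b = (\<Sum>i\<in>#P. x i) - (\<Sum>i\<in>#Q. x i)"
      by (rule zero_sum_span_multisets[OF finite_atLeastAtMost ab(3)])
    have "a + (\<Sum>i\<in>#Q. x i) = b + (\<Sum>i\<in>#P. x i)" using PQ(5) by (simp add: algebra_simps)
    moreover have "set_mset P \<subseteq> {1..n}" "set_mset Q \<subseteq> {1..n}" using PQ(1,2) assms(2) by auto
    ultimately obtain w where w: "w \<in> M" "a = w + (\<Sum>i\<in>#P. x i)" "b = w + (\<Sum>i\<in>#Q. x i)"
      using factor_disjoint_generators[OF assms(1) _ _ PQ(3) ab(1,2)] by blast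
    have "monomial w * (monomial (\<Sum>i\<in>#P. x i) - monomial (\<Sum>i\<in>#Q. x i)) \<in> binomial_ideal k"
      using equal_size_binomial_in_binomial_ideal[OF assms(2) PQ(1,2,4)] w(1)
      by (intro ideal_closed(4)[OF I]) auto
    then show "monomial a - monomial b \<in> binomial_ideal k"
      unfolding w(2,3) by (simp add: right_diff_distrib monomial_mult)
  qed
qed

lemma U_eq_generate:
  "1 \<le> k \<Longrightarrow> U k = generate lattice_group ((\<lambda>i. x i - x (i + 1)) ` {1..<k})"
  by (rule generate_consecutive_differences[symmetric])

lemma primeideal_balanced_if_saturated:
  assumes "1 \<le> k" and sat: "\<And>g N. g \<in> gp M \<Longrightarrow> N \<noteq> 0 \<Longrightarrow> N *s g \<in> U k \<Longrightarrow> g \<in> U k"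
  shows "primeideal (balanced (U k)) R"
proof -
  have "finite ((\<lambda>i. x i - x (i + 1)) ` {1..<k})" by simp
  from linear_map_with_saturated_kernel[OF this, folded U_eq_generate[OF assms(1)]]
  obtain \<phi> :: "int ^ 'm \<Rightarrow> int ^ 'm" where add: "\<And>a b. \<phi> (a + b) = \<phi> a + \<phi> b"
    and ker: "\<And>z. \<phi> z = 0 \<longleftrightarrow> (\<exists>N. N \<noteq> 0 \<and> N *s z \<in> U k)" by auto
  obtain \<psi> :: "int ^ 'm \<Rightarrow> nat \<Rightarrow>\<^sub>0 int" where \<psi>: "\<And>a b. \<psi> (a + b) = \<psi> a + \<psi> b" "inj \<psi>"
    by (rule lattice_embeds_in_ordered_group) blast
  show ?thesis
  proof (rule primeideal_balanced[OF subgroup_zero_sum_span, of "\<lambda>a. \<psi> (\<phi> a)"])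
    fix a b assume "a \<in> M" "b \<in> M"
    then have g: "a - b \<in> gp M" unfolding gp_eq_differences[OF submonoid_M] by blast
    have "\<phi> (a - b) = \<phi> a - \<phi> b" using add[of "a - b" b] by (simp add: eq_diff_eq)
    then have "\<psi> (\<phi> a) = \<psi> (\<phi> b) \<longleftrightarrow> \<phi> (a - b) = 0" using inj_eq[OF \<psi>(2)] by simp
    also have "\<dots> \<longleftrightarrow> a - b \<in> U k"
    proof
      assume "\<phi> (a - b) = 0"
      then show "a - b \<in> U k" using ker sat g by blast
    next
      assume "a - b \<in> U k"
      then show "\<phi> (a - b) = 0" unfolding ker by (intro exI[of _ 1]) simp
    qed
    finally show "a - b \<in> U k \<longleftrightarrow> \<psi> (\<phi> a) = \<psi> (\<phi> b)" by blast
  qed (simp add: add \<psi>(1))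
qed

lemma sum_truncate:
  assumes "k \<le> n"
  shows "(\<Sum>i\<in>{1..n}. if i \<le> k then c i else 0) = (\<Sum>i\<in>{1..k}. c i)"
    and "(\<Sum>i\<in>{1..n}. (if i \<le> k then e i else 0) *s x i) = (\<Sum>i\<in>{1..k}. e i *s x i)"
  using assms by (auto intro!: sum.mono_neutral_cong_right)

text \<open>\<open>U n / U k\<close> is torsion-free: by independence the coefficients of \<open>g\<close> can be read off from those
of \<open>N *s g\<close>.\<close>

lemma saturated_truncation:
  assumes indep: "int_affine_independent {1..n} x" and "k \<le> n"
    and g: "g \<in> U n" "N \<noteq> 0" "N *s g \<in> U k"
  shows "g \<in> U k"
proof -
  obtain c where c: "g = (\<Sum>i\<in>{1..n}. c i *s x i)" "(\<Sum>i\<in>{1..n}. c i) = 0"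
    using g(1) unfolding zero_sum_span_def by blast
  obtain e where e: "N *s g = (\<Sum>i\<in>{1..k}. e i *s x i)" "(\<Sum>i\<in>{1..k}. e i) = 0"
    using g(3) unfolding zero_sum_span_def by blast
  let ?f = "\<lambda>i. N * c i - (if i \<le> k then e i else 0)"
  have "(\<Sum>i\<in>{1..n}. ?f i) = N * (\<Sum>i\<in>{1..n}. c i) - (\<Sum>i\<in>{1..k}. e i)"
    by (simp only: sum_subtractf sum_truncate[OF assms(2)] sum_distrib_left)
  then have f0: "(\<Sum>i\<in>{1..n}. ?f i) = 0" using c(2) e(2) by simp
  have "(\<Sum>i\<in>{1..n}. ?f i *s x i) = N *s (\<Sum>i\<in>{1..n}. c i *s x i) - (\<Sum>i\<in>{1..k}. e i *s x i)"
    by (simp only: int_lattice.scale_left_diff_distrib sum_subtractf sum_truncate[OF assms(2)]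
        int_lattice.scale_sum_right int_lattice.scale_scale)
  then have "(\<Sum>i\<in>{1..n}. ?f i *s x i) = 0" using c(1) e(1) by simp
  with indep[unfolded int_affine_independent_def, THEN spec, of ?f] f0
  have f: "\<forall>i\<in>{1..n}. ?f i = 0" by blast
  have c0: "c i = (if i \<le> k then c i else 0)" if "i \<in> {1..n}" for i
    using bspec[OF f that] g(2) by (auto split: if_splits)
  have "(\<Sum>i\<in>{1..n}. c i) = (\<Sum>i\<in>{1..n}. if i \<le> k then c i else 0)"
    by (rule sum.cong[OF refl c0])
  then have "(\<Sum>i\<in>{1..k}. c i) = 0" using c(2) sum_truncate(1)[OF assms(2), of c] by simp
  moreover have "(\<Sum>i\<in>{1..n}. c i *s x i) = (\<Sum>i\<in>{1..n}. (if i \<le> k then c i else 0) *s x i)"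
    by (rule sum.cong[OF refl], subst c0) auto
  then have "g = (\<Sum>i\<in>{1..k}. c i *s x i)" using c(1) sum_truncate(2)[OF assms(2), of c] by simp
  ultimately show ?thesis unfolding zero_sum_span_def by blast
qed

lemma next_difference_notin_U:
  assumes indep: "int_affine_independent {1..n} x" and k: "1 \<le> k" "k < n"
  shows "x k - x (k + 1) \<notin> U k"
proof
  assume "x k - x (k + 1) \<in> U k"
  then obtain c where c: "x k - x (k + 1) = (\<Sum>i\<in>{1..k}. c i *s x i)" "(\<Sum>i\<in>{1..k}. c i) = 0"
    unfolding zero_sum_span_def by blast
  let ?f = "\<lambda>i. ((if i \<le> k then c i else 0) - (if i = k then 1 else 0)) + (if i = k + 1 then 1 else 0)"
  have kn: "k \<le> n" using k by simp
  have "(\<Sum>i\<in>{1..n}. ?f i) = 0"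
    unfolding sum.distrib sum_subtractf sum_truncate(1)[OF kn] using c(2) k by simp
  moreover have "(\<Sum>i\<in>{1..n}. ?f i *s x i) = (\<Sum>i\<in>{1..k}. c i *s x i) - x k + x (k + 1)"
    unfolding int_lattice.scale_left_distrib int_lattice.scale_left_diff_distrib sum.distrib sum_subtractf
      sum_truncate(2)[OF kn]
    using k by (simp add: sum_scale_indicator)
  then have "(\<Sum>i\<in>{1..n}. ?f i *s x i) = 0" unfolding c(1)[symmetric] by simp
  ultimately have "\<forall>i\<in>{1..n}. ?f i = 0"
    using indep[unfolded int_affine_independent_def, THEN spec, of ?f] by blast
  from bspec[OF this, of "k + 1"] show False using k by simp
qed

lemma binomials_regular_and_prime:
  assumes pw: pairwise_regular and indep: "int_affine_independent {1..n} x"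
    and sat: "\<And>g N. g \<in> gp M \<Longrightarrow> N \<noteq> 0 \<Longrightarrow> N *s g \<in> U n \<Longrightarrow> g \<in> U n"
  shows "regular_sequence R (map (\<lambda>i. monomial (x i) - monomial (x (i + 1))) [1..<n])"
    and "primeideal (binomial_ideal n) R"
proof -
  have sub: "U k \<subseteq> U n" if "1 \<le> k" "k \<le> n" for k
    unfolding U_eq_generate[OF that(1)]
    by (rule generate_lattice_minimal[OF subgroup_zero_sum_span])
       (use that in \<open>auto intro!: diff_in_zero_sum_span simp del: One_nat_def\<close>)
  have prime: "primeideal (binomial_ideal k) R" if k: "1 \<le> k" "k \<le> n" for k
    unfolding binomial_ideal_eq_balanced[OF pw k(2)]
  proof (rule primeideal_balanced_if_saturated[OF k(1)])
    fix g N assume g: "g \<in> gp M" "N \<noteq> 0" "N *s g \<in> U k"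
    then have "g \<in> U n" using sat sub[OF k] by blast
    then show "g \<in> U k" using g(2,3) by (rule saturated_truncation[OF indep k(2)])
  qed
  show "primeideal (binomial_ideal n) R" using n_pos by (intro prime) auto
  then have "binomial_ideal n \<noteq> carrier R" using primeideal.I_notcarr by blast
  moreover have "h \<in> binomial_ideal k"
    if k: "k \<in> {1..<n}" and h: "h \<in> carrier R" "(monomial (x k) - monomial (x (k + 1))) * h \<in> binomial_ideal k"
    for k h
  proof -
    have d: "monomial (x k) - monomial (x (k + 1)) \<in> carrier R"
      using binomial_generators_in_carrier[OF order_refl] k by blast
    have "monomial (x k) - monomial (x (k + 1)) \<notin> binomial_ideal k"
      using k next_difference_notin_U[OF indep, of k] x_in_M[of k] x_in_M[of "k + 1"]
      by (simp add: binomial_ideal_eq_balanced[OF pw] binomial_in_balanced_iff[OF subgroup_zero_sum_span])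
    then show ?thesis using primeideal.I_prime[OF prime[of k] d h(1)] h(2) k by auto
  qed
  ultimately show "regular_sequence R (map (\<lambda>i. monomial (x i) - monomial (x (i + 1))) [1..<n])"
    unfolding regular_sequence_map_iff binomial_ideal_def[symmetric]
    using binomial_generators_in_carrier[OF order_refl] by blast
qed

section \<open>Consequences of a prime ideal generated by regular binomials\<close>

text \<open>With \<open>r\<close> the order of \<open>a - b\<close> modulo \<open>U k\<close>, some \<open>X^q (X^(ra) - X^(rb))\<close> is in the ideal, and
it factors as \<open>(X^a - X^b) h\<close>, where \<open>h\<close> is a geometric sum with terms in distinct cosets.\<close>

lemma torsion_witness:
  assumes k: "k \<le> n" and ab: "a \<in> M" "b \<in> M" and N: "N \<noteq> 0" "N *s (a - b) \<in> U k"
  obtains h where "h \<in> carrier R" "h \<notin> balanced (U k)" "(monomial a - monomial b) * h \<in> binomial_ideal k"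
proof -
  let ?g = "a - b"
  have S: "subgroup (U k) lattice_group" by (rule subgroup_zero_sum_span)
  have "\<bar>N\<bar> *s ?g \<in> U k"
    using N(2) lattice_subgroup_closed(3)[OF S N(2)] by (cases "N \<ge> 0") auto
  then have "nat \<bar>N\<bar> > 0 \<and> int (nat \<bar>N\<bar>) *s ?g \<in> U k" using N(1) by simp
  then obtain r where r: "r > 0" "int r *s ?g \<in> U k"
    and min: "\<And>i. i > 0 \<Longrightarrow> int i *s ?g \<in> U k \<Longrightarrow> r \<le> i"
    using ex_has_least_nat[of "\<lambda>i. i > 0 \<and> int i *s ?g \<in> U k" "nat \<bar>N\<bar>" "\<lambda>i. i"] by blast
  have "int r *s a - int r *s b \<in> U k" using r(2) by (simp add: int_lattice.scale_right_diff_distrib)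
  from shifted_binomial_in_binomial_ideal[OF k scale_in_M[OF ab(1)] scale_in_M[OF ab(2)] this]
  obtain q where q: "q \<in> M"
    "monomial q * (monomial (int r *s a) - monomial (int r *s b)) \<in> binomial_ideal k" .
  define c where "c = q + int (r - 1) *s b"
  define h where "h = (\<Sum>i<r. monomial (c + int i *s ?g) :: (int ^ 'm) \<Rightarrow>\<^sub>0 'k)"
  have "c + int i *s ?g \<in> M" if "i < r" for i
  proof -
    have "c + int i *s ?g = q + int i *s a + int (r - 1 - i) *s b"
      using that by (simp add: c_def of_nat_diff int_lattice.scale_right_diff_distrib
          int_lattice.scale_left_diff_distrib int_lattice.scale_left_distrib)
    then show ?thesis using q(1) scale_in_M ab add_in_M by metis
  qed
  then have "h \<in> carrier R"
    unfolding h_def using Poly_Mapping.keys_sum[of "\<lambda>i. monomial (c + int i *s ?g) :: (int ^ 'm) \<Rightarrow>\<^sub>0 'k" "{..<r}"]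
    by auto
  moreover have "h \<notin> balanced (U k)"
    unfolding h_def
  proof (rule geometric_sum_notin_balanced[OF S r(1)])
    fix i assume "0 < i" "i < r"
    then show "int i *s ?g \<notin> U k" using min[of i] by (meson not_le)
  qed
  moreover have "(monomial a - monomial b) * h \<in> binomial_ideal k"
  proof -
    let ?T = "\<lambda>i. monomial (c + b + int i *s ?g) :: (int ^ 'm) \<Rightarrow>\<^sub>0 'k"
    have "(monomial a - monomial b) * monomial (c + int i *s ?g) = ?T (Suc i) - ?T i" for i
      by (simp add: left_diff_distrib monomial_mult int_lattice.scale_left_distrib algebra_simps)
    then have "(monomial a - monomial b) * h = (\<Sum>i<r. ?T (Suc i) - ?T i)"
      by (simp add: h_def sum_distrib_left)
    also have "\<dots> = ?T r - ?T 0" by (rule sum_lessThan_telescope)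
    also have "c + b + int r *s ?g = q + int r *s a"
      using r(1) by (simp add: c_def of_nat_diff int_lattice.scale_right_diff_distrib int_lattice.scale_left_diff_distrib)
    also have "c + b + int 0 *s ?g = q + int r *s b"
      using r(1) by (simp add: c_def of_nat_diff int_lattice.scale_left_diff_distrib)
    finally show ?thesis using q(2) by (simp add: right_diff_distrib monomial_mult)
  qed
  ultimately show thesis by (rule that)
qed

lemma saturated_if_prime:
  assumes prime: "primeideal (binomial_ideal n) R" and g: "g \<in> gp M" "N \<noteq> 0" "N *s g \<in> U n"
  shows "g \<in> U n"
proof -
  obtain a b where ab: "a \<in> M" "b \<in> M" "g = a - b"
    using g(1) unfolding gp_eq_differences[OF submonoid_M] by blast
  obtain h where h: "h \<in> carrier R" "h \<notin> balanced (U n)" "(monomial a - monomial b) * h \<in> binomial_ideal n"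
    using torsion_witness[OF order_refl ab(1,2) g(2)] g(3) ab(3) by blast
  have sub: "binomial_ideal n \<subseteq> balanced (U n)" by (rule binomial_ideal_subset_balanced) simp
  have "monomial a - monomial b \<in> carrier R"
    using diff_carrier[of "monomial a" "monomial b"] ab by simp
  then have "monomial a - monomial b \<in> binomial_ideal n"
    using primeideal.I_prime[OF prime _ h(1)] h(2,3) sub by auto
  then show ?thesis
    using sub binomial_in_balanced_iff[OF subgroup_zero_sum_span ab(1,2)] ab(3) by blast
qed

lemma binomial_in_prime_binomial_ideal:
  assumes prime: "primeideal (binomial_ideal n) R" and ab: "a \<in> M" "b \<in> M" "a - b \<in> U n"
  shows "monomial a - monomial b \<in> binomial_ideal n"
proof -
  obtain q where q: "q \<in> M" "monomial q * (monomial a - monomial b) \<in> binomial_ideal n"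
    using shifted_binomial_in_binomial_ideal[OF order_refl ab] by blast
  have "monomial a - monomial b \<in> carrier R"
    using diff_carrier[of "monomial a" "monomial b"] ab by simp
  moreover have "monomial q \<notin> binomial_ideal n"
    using binomial_ideal_subset_balanced[OF order_refl] monomial_notin_balanced by blast
  ultimately show ?thesis
    using primeideal.I_prime[OF prime, of "monomial q" "monomial a - monomial b"] q by auto
qed

text \<open>In a minimal affine relation the last difference \<open>x k - x (k + 1)\<close> is torsion modulo \<open>U k\<close>. Then
the witness above is annihilated by the nonzerodivisor \<open>X^x\<^sub>k - X^x\<^sub>k\<^sub>+\<^sub>1\<close> modulo the ideal of the
preceding binomials, although it is not balanced.\<close>

lemma affinely_independent_if_regular:
  assumes "regular_sequence R (map (\<lambda>i. monomial (x i) - monomial (x (i + 1))) [1..<n])"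
  shows "int_affine_independent {1..n} x"
proof -
  have nzd: "h \<in> binomial_ideal k"
    if "k \<in> {1..<n}" "h \<in> carrier R" "(monomial (x k) - monomial (x (k + 1))) * h \<in> binomial_ideal k" for k h
    using assms that unfolding regular_sequence_map_iff binomial_ideal_def[symmetric] by blast
  have notin: "N *s (x k - x (k + 1)) \<notin> U k" if k: "k \<in> {1..<n}" and N: "N \<noteq> 0" for k N
  proof
    assume "N *s (x k - x (k + 1)) \<in> U k"
    moreover have "k \<le> n" "x k \<in> M" "x (k + 1) \<in> M" using k by (auto intro!: x_in_M)
    ultimately obtain h where "h \<in> carrier R" "h \<notin> balanced (U k)"
      "(monomial (x k) - monomial (x (k + 1))) * h \<in> binomial_ideal k"
      using torsion_witness N by blast
    then show False using nzd[OF k] binomial_ideal_subset_balanced[OF \<open>k \<le> n\<close>] by blast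
  qed
  have "int_affine_independent {1..k} x" if "1 \<le> k" "k \<le> n" for k
    using that
  proof (induct k rule: nat_induct_at_least)
    case base
    show ?case by (simp add: int_affine_independent_def)
  next
    case (Suc k)
    show ?case
      unfolding int_affine_independent_def
    proof (intro allI impI)
      fix c assume c: "(\<Sum>i\<in>{1..Suc k}. c i) = 0" "(\<Sum>i\<in>{1..Suc k}. c i *s x i) = 0"
      let ?r = "c (Suc k)"
      have c': "(\<Sum>i\<in>{1..k}. c i) = - ?r" "(\<Sum>i\<in>{1..k}. c i *s x i) = - (?r *s x (Suc k))"
        using c Suc(1) by (simp_all add: eq_neg_iff_add_eq_0)
      have r0: "?r = 0"
      proof (rule ccontr)
        assume "?r \<noteq> 0"
        let ?e = "\<lambda>i. c i + (if i = k then ?r else 0)"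
        have "(\<Sum>i\<in>{1..k}. ?e i) = 0"
          unfolding sum.distrib c' using Suc(1) by simp
        moreover have "(\<Sum>i\<in>{1..k}. ?e i *s x i) = - (?r *s x (Suc k)) + ?r *s x k"
          unfolding int_lattice.scale_left_distrib sum.distrib c'(2)
          using Suc(1) by (simp add: sum_scale_indicator)
        moreover have "- (?r *s x (Suc k)) + ?r *s x k = ?r *s (x k - x (k + 1))"
          by (simp add: int_lattice.scale_right_diff_distrib)
        ultimately have "?r *s (x k - x (k + 1)) \<in> U k"
          unfolding zero_sum_span_def by (intro CollectI exI[of _ ?e]) simp
        then show False using notin[of k ?r] \<open>?r \<noteq> 0\<close> Suc by simp
      qed
      then have "(\<Sum>i\<in>{1..k}. c i) = 0" "(\<Sum>i\<in>{1..k}. c i *s x i) = 0" using c' by simp_all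
      moreover have "int_affine_independent {1..k} x" using Suc by simp
      ultimately have "\<forall>i\<in>{1..k}. c i = 0" unfolding int_affine_independent_def by blast
      then show "\<forall>i\<in>{1..Suc k}. c i = 0" using r0 by (auto simp: le_Suc_eq)
    qed
  qed
  then show ?thesis using n_pos by simp
qed

text \<open>The binomial ideal lies in the monomial ideal generated by the \<open>X^x\<^sub>i\<close>, and membership in the
latter is visible on the support.\<close>

lemma divisible_if_balanced_distinct:
  assumes prime: "primeideal (binomial_ideal n) R" and ab: "a \<in> M" "b \<in> M" "a - b \<in> U n" "a \<noteq> b"
  shows "\<exists>l\<in>{1..n}. a - x l \<in> M"
proof -
  let ?J = "Idl\<^bsub>R\<^esub> ((\<lambda>i. monomial (x i)) ` {1..n})"
  have G: "(\<lambda>i. monomial (x i) :: (int ^ 'm) \<Rightarrow>\<^sub>0 'k) ` {1..n} \<subseteq> carrier R" using x_in_M by auto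
  have J: "ideal ?J R" using G by (rule ideal_Idl)
  have "binomial_ideal n \<subseteq> ?J"
  proof (rule binomial_ideal_minimal[OF J])
    fix i assume "i \<in> {1..<n}"
    then have "i \<in> {1..n}" "i + 1 \<in> {1..n}" by auto
    then show "monomial (x i) - monomial (x (i + 1)) \<in> ?J"
      using ideal_closed(5)[OF J subsetD[OF Idl_superset[OF G] imageI] subsetD[OF Idl_superset[OF G] imageI]]
      by blast
  qed
  moreover have "?J = {f. \<forall>a\<in>Poly_Mapping.keys f. \<exists>j\<in>{1..n}. a - x j \<in> M}"
    by (rule Idl_monomials) (use x_in_M in auto)
  ultimately show ?thesis
    using binomial_in_prime_binomial_ideal[OF prime ab(1-3)] keys_binomial[OF ab(4)] by blast
qed

text \<open>Degrees within a coset are bounded below: otherwise, by Dickson's lemma, some \<open>w \<in> M\<close> is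
congruent to a negative multiple of \<open>x 1\<close>. Then \<open>0\<close> is congruent to \<open>w\<close> plus a positive multiple of
\<open>x 1\<close>, so that \<open>0\<close> is divisible by some \<open>x l\<close>, or else \<open>x 1\<close> is invertible.\<close>

lemma bounded_descent:
  assumes prime: "primeideal (binomial_ideal n) R" and "a \<in> M"
  obtains t u where "u \<in> U n" "a - int t *s x 1 - u \<in> M"
    "\<forall>v\<in>U n. a - int (Suc t) *s x 1 - v \<notin> M"
proof -
  have S: "subgroup (U n) lattice_group" by (rule subgroup_zero_sum_span)
  have one: "1 \<in> {1..n}" using n_pos by simp
  let ?D = "\<lambda>t. \<exists>u\<in>U n. a - int t *s x 1 - u \<in> M"
  have "?D 0" using assms(2) lattice_subgroup_closed(1)[OF S] by (intro bexI[of _ 0]) simp_all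
  have "\<exists>t. \<not> ?D t"
  proof (rule ccontr)
    assume "\<nexists>t. \<not> ?D t"
    then obtain u where u: "\<And>t. u t \<in> U n" "\<And>t. a - int t *s x 1 - u t \<in> M" by metis
    obtain k l where kl: "k < l" "(a - int l *s x 1 - u l) - (a - int k *s x 1 - u k) \<in> M"
      by (rule affine_monoid_wqo[OF affine_M u(2)])
    define w where "w = (a - int l *s x 1 - u l) - (a - int k *s x 1 - u k)"
    have w: "w = (u k - u l) - int (l - k) *s x 1"
      using kl(1) by (simp add: w_def of_nat_diff int_lattice.scale_left_diff_distrib)
    have wM: "w \<in> M" using kl(2) by (simp add: w_def)
    then have "w + int (l - k) *s x 1 \<in> M" by (intro add_in_M scale_in_M x_in_M[OF one])
    then have vM: "u k - u l \<in> M" by (simp add: w)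
    have vU: "0 - (u k - u l) \<in> U n"
      using lattice_subgroup_closed(4)[OF S u(1)[of l] u(1)[of k]] by simp
    show False
    proof (cases "0 = u k - u l")
      case True
      then have "w + int (l - k - 1) *s x 1 = (int (l - k - 1) - int (l - k)) *s x 1"
        unfolding w int_lattice.scale_left_diff_distrib by simp
      also have "int (l - k - 1) - int (l - k) = - 1" using kl(1) by simp
      finally have "w + int (l - k - 1) *s x 1 = - x 1" by simp
      moreover have "w + int (l - k - 1) *s x 1 \<in> M" using wM by (intro add_in_M scale_in_M x_in_M[OF one])
      ultimately show False using noninvertible[OF one] by simp
    next
      case False
      from divisible_if_balanced_distinct[OF prime zero_in_M vM vU False]
      show False using noninvertible by auto
    qed
  qed
  moreover have "?D t" if "\<And>t. ?D t \<Longrightarrow> ?D (Suc t)" for t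
    using that \<open>?D 0\<close> by (rule nat_induct[rotated])
  ultimately obtain t where "?D t" "\<not> ?D (Suc t)" by blast
  then show thesis using that by blast
qed

text \<open>Let \<open>e\<close> be an element of lowest degree in the coset of \<open>a\<close>. By induction on the degree \<open>s\<close>, every
\<open>z\<close> of degree \<open>s\<close> above \<open>e\<close> is \<open>e\<close> plus a sum of \<open>s\<close> generators: either it equals \<open>e + s x\<^sub>1\<close> or
it is divisible by some \<open>x l\<close>, and \<open>z - x l\<close> has degree \<open>s - 1\<close>, which is impossible for \<open>s = 0\<close>.
Now \<open>a\<close> and \<open>z = a + x i - x j\<close> have the same degree, and comparing their representations shows
that \<open>x j\<close> occurs in the one of \<open>a\<close>.\<close>

lemma pairwise_regular_if_prime:
  assumes prime: "primeideal (binomial_ideal n) R" and indep: "int_affine_independent {1..n} x"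
  shows pairwise_regular
  unfolding pairwise_regular_def regular_modulo_def
proof (intro ballI impI)
  fix i j a
  assume i: "i \<in> {1..n}" and j: "j \<in> {1..n}" and "i \<noteq> j" and a: "a \<in> M"
    and "\<exists>j\<in>{j}. a + x i - x j \<in> M"
  then have z: "a + x i - x j \<in> M" by blast
  have S: "subgroup (U n) lattice_group" by (rule subgroup_zero_sum_span)
  have one: "1 \<in> {1..n}" using n_pos by simp
  have diffU: "x p - x q \<in> U n" if "p \<in> {1..n}" "q \<in> {1..n}" for p q
    using that by (intro diff_in_zero_sum_span) auto
  obtain t u where u: "u \<in> U n" and e: "a - int t *s x 1 - u \<in> M"
    and max: "\<forall>v\<in>U n. a - int (Suc t) *s x 1 - v \<notin> M"
    by (rule bounded_descent[OF prime a])
  let ?e = "a - int t *s x 1 - u"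
  have decompose: "\<exists>P. set_mset P \<subseteq> {1..n} \<and> size P = s \<and> z = ?e + (\<Sum>i\<in>#P. x i)"
    if "z \<in> M" "z - ?e - int s *s x 1 \<in> U n" for s z
    using that
  proof (induct s arbitrary: z)
    case 0
    have "z = ?e"
    proof (rule ccontr)
      assume "z \<noteq> ?e"
      moreover have zU: "z - ?e \<in> U n" using 0(2) by simp
      ultimately obtain l where l: "l \<in> {1..n}" "z - x l \<in> M"
        using divisible_if_balanced_distinct[OF prime 0(1) e] by blast
      \<comment> \<open>\<open>z - x l\<close> has degree one less than \<open>e\<close>, against the choice of \<open>t\<close>.\<close>
      let ?v = "u - (z - ?e) - (x 1 - x l)"
      have "?v \<in> U n"
        by (rule lattice_subgroup_closed(4)[OF S lattice_subgroup_closed(4)[OF S u zU] diffU[OF one l(1)]])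
      moreover have "a - int (Suc t) *s x 1 - ?v = z - x l"
        by (simp add: int_lattice.scale_left_distrib)
      ultimately show False using max l(2) by metis
    qed
    then show ?case by (intro exI[of _ "{#}"]) simp
  next
    case (Suc s)
    let ?v = "?e + int (Suc s) *s x 1"
    show ?case
    proof (cases "z = ?v")
      case True
      moreover have "(\<Sum>i\<in>#replicate_mset r 1. x i) = int r *s x 1" for r
        by (induct r) (simp_all add: int_lattice.scale_left_distrib)
      ultimately show ?thesis using one by (intro exI[of _ "replicate_mset (Suc s) 1"])
          (auto simp: int_lattice.scale_left_distrib)
    next
      case False
      have vM: "?v \<in> M" by (intro add_in_M e scale_in_M x_in_M one)
      have "z - ?v \<in> U n" using Suc(3) by (simp add: algebra_simps)
      then obtain l where l: "l \<in> {1..n}" "z - x l \<in> M"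
        using divisible_if_balanced_distinct[OF prime Suc(2) vM _ False] by blast
      have "(z - x l) - ?e - int s *s x 1 = (z - ?e - int (Suc s) *s x 1) + (x 1 - x l)"
        by (simp add: int_lattice.scale_left_distrib)
      then have "(z - x l) - ?e - int s *s x 1 \<in> U n"
        using lattice_subgroup_closed(2)[OF S Suc(3) diffU[OF one l(1)]] by (simp only:)
      from Suc(1)[OF l(2) this] obtain P where
        P: "set_mset P \<subseteq> {1..n}" "size P = s" "z - x l = ?e + (\<Sum>i\<in>#P. x i)" by blast
      have "z = ?e + (\<Sum>i\<in>#P. x i) + x l" using P(3) by (simp only: diff_eq_eq)
      then show ?thesis using l(1) P(1,2) by (intro exI[of _ "add_mset l P"]) (simp add: add_ac)
    qed
  qed
  have "a - ?e - int t *s x 1 = u" by simp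
  then obtain P where P: "set_mset P \<subseteq> {1..n}" "size P = t" "a = ?e + (\<Sum>i\<in>#P. x i)"
    using decompose[OF a, of t] u by metis
  have "(a + x i - x j) - ?e - int t *s x 1 = u + (x i - x j)" by simp
  then have "(a + x i - x j) - ?e - int t *s x 1 \<in> U n"
    using lattice_subgroup_closed(2)[OF S u diffU[OF i j]] by metis
  from decompose[OF z this] obtain Q where
    Q: "set_mset Q \<subseteq> {1..n}" "size Q = t" "a + x i - x j = ?e + (\<Sum>i\<in>#Q. x i)" by blast
  have "?e + (\<Sum>i\<in>#P. x i) + x i = ?e + (\<Sum>i\<in>#Q. x i) + x j"
    using Q(3) P(3) by (metis diff_add_cancel)
  then have "(\<Sum>k\<in>#add_mset i P. x k) = (\<Sum>k\<in>#add_mset j Q. x k)"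
    by (simp add: add_ac)
  then have "add_mset i P = add_mset j Q"
    using i j P(1,2) Q(1,2) by (intro int_affine_independent_multisets[OF indep]) auto
  then have "j \<in># P" using \<open>i \<noteq> j\<close> by (metis insert_noteq_member)
  then obtain P' where P': "P = add_mset j P'" by (metis multi_member_split)
  then have "(\<Sum>k\<in>#P'. x k) \<in> M" using P(1) by (intro sum_mset_in_M) auto
  then have "?e + (\<Sum>k\<in>#P'. x k) \<in> M" using e by (intro add_in_M)
  moreover have "a - x j = ?e + (\<Sum>k\<in>#P'. x k)"
  proof -
    have cancel: "A = B + (y + C) \<Longrightarrow> A - y = B + C" for A B C y :: "int ^ 'm" by simp
    have "(\<Sum>k\<in>#P. x k) = x j + (\<Sum>k\<in>#P'. x k)" by (simp add: P')
    then show ?thesis by (intro cancel trans[OF P(3)]) (simp only:)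
  qed
  ultimately show "\<exists>j\<in>{j}. a - x j \<in> M" by (intro bexI[of _ j]) (simp_all only: singletonI)
qed

end

theorem corollary2p3:
  fixes M :: "(int ^ 'm) set"
    and R :: "((int ^ 'm) \<Rightarrow>\<^sub>0 'k::field) ring"
    and n :: nat
    and x :: "nat \<Rightarrow> int ^ 'm"
  assumes "affine_monoid M"
    and "R = monoid_algebra M"
    and "n \<ge> 2"
    and "\<And>i. i \<in> {1..n} \<Longrightarrow> x i \<in> M \<and> \<not> invertible_in M (x i)"
  shows "(regular_sequence R (map (\<lambda>i. monomial (x i) - monomial (x (i + 1))) [1..<n]) \<and>
          primeideal (Idl\<^bsub>R\<^esub> ((\<lambda>i. monomial (x i) - monomial (x (i + 1))) ` {1..<n})) R)
     \<longleftrightarrow>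
         (regular_sequence R (map (\<lambda>i. monomial (x i)) [1..<n + 1]) \<and>
          direct_summand (generate lattice_group ((\<lambda>i. x i - x (i + 1)) ` {1..<n})) (gp M) \<and>
          lattice_rank (generate lattice_group ((\<lambda>i. x i - x (i + 1)) ` {1..<n})) = n - 1)"
proof -
  interpret noninvertible_family M R x n
    by (intro noninvertible_family.intro lattice_monoid_algebra.intro noninvertible_family_axioms.intro)
       (use assms affine_monoid_submonoid[OF assms(1)] in \<open>auto simp: invertible_in_def\<close>)
  let ?G = "generate lattice_group ((\<lambda>i. x i - x (i + 1)) ` {1..<n})"
  have G: "?G = U n" using U_eq_generate[OF n_pos] by simp
  have rank: "lattice_rank (U n) = n - 1 \<longleftrightarrow> int_affine_independent {1..n} x"
    using lattice_rank_zero_sum_span[of "{1..n}" x] n_pos by simp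
  have gpM: "subgroup (gp M) lattice_group" unfolding gp_def by (rule subgroup_generate_lattice)
  show ?thesis
    unfolding G rank regular_monomials_iff binomial_ideal_def[symmetric]
  proof (intro iffI conjI; elim conjE)
    assume reg: "regular_sequence R (map (\<lambda>i. monomial (x i) - monomial (x (i + 1))) [1..<n])"
      and prime: "primeideal (binomial_ideal n) R"
    show indep: "int_affine_independent {1..n} x" using reg by (rule affinely_independent_if_regular)
    show pairwise_regular using prime indep by (rule pairwise_regular_if_prime)
    have "M \<subseteq> gp M" unfolding gp_def by (auto intro: generate.incl)
    then have "?G \<subseteq> gp M"
      using x_in_M by (intro generate_lattice_minimal[OF gpM] image_subsetI lattice_subgroup_closed(4)[OF gpM]) auto
    then have sub: "U n \<subseteq> gp M" by (simp only: G)
    show "direct_summand (U n) (gp M)"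
    proof (rule saturated_direct_summand[OF _ G[symmetric] gpM sub])
      show "g \<in> U n" if "g \<in> gp M" "N \<noteq> 0" "N *s g \<in> U n" for g N
        using prime that by (rule saturated_if_prime)
    qed simp
  next
    assume pw: pairwise_regular and summand: "direct_summand (U n) (gp M)"
      and indep: "int_affine_independent {1..n} x"
    have sat: "g \<in> U n" if "g \<in> gp M" "N \<noteq> 0" "N *s g \<in> U n" for g N
      using summand that by (rule direct_summand_saturated)
    show "regular_sequence R (map (\<lambda>i. monomial (x i) - monomial (x (i + 1))) [1..<n])"
      by (rule binomials_regular_and_prime(1)[OF pw indep sat])
    show "primeideal (binomial_ideal n) R"
      by (rule binomials_regular_and_prime(2)[OF pw indep sat])
  qed
qed

end
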